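(* Let $r,s\ge2$ and let $F:U\to\mathbb P^{r',s',t'}$ be a local orthogonal map, where $U\subset\mathbb P^{r,s,t}$ is a connected open set containing a null point. If $\min\{r',s'\}\le\min\{r,s\}$, then $F$ is either null or quasi-linear (and, when $t'=0$, either null or linear). If in addition $F$ maps at least one positive point to a positive point, or at least one negative point to a negative point, then $F$ is quasi-standard (standard when $t'=0$).
   Context: Let $r,s,t\ge 0$ be integers with $n=r+s+t>0$. $\mathbb C^{r,s,t}$ denotes $\mathbb C^n$ equipped with the (possibly degenerate, indefinite) Hermitian form $\langle z,w\rangle_{r,s,t}=\sum_{j=1}^{r}z_j\bar w_j-\sum_{j=r+1}^{r+s}z_j\bar w_j$, and $\mathbb P^{r,s,t}$ is its projectivization. A point $[z]$ is positive, negative or null according as $\langle z,z\rangle_{r,s,t}>0$, $<0$ or $=0$; $[z]\perp[w]$ if $\langle z,w\rangle_{r,s,t}=0$. A complex linear subspace $H$ (or $\mathbb PH$) is a null space if the form vanishes identically on $H$. Let $U\subset\mathbb P^{r,s,t}$ be a connected open set containing a null point. A holomorphic map $F:U\to\mathbb P^{r',s',t'}$ is a local orthogonal map if $F(p)\perp F(q)$ for all $p,q\in U$ with $p\perp q$. $F$ is linear if it extends to a rational map induced by a linear map $\mathbb C^{r+s+t}\to\mathbb C^{r'+s'+t'}$; standard if it is induced by a linear isometry $\mathbb C^{r,s,t}\to\mathbb C^{r',s',t'}$ (a linear map $L$ with $\langle Lu,Lv\rangle_{r',s',t'}=\langle u,v\rangle_{r,s,t}$); null if $F(U)$ is contained in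 a null space. $F$ is quasi-standard (resp. quasi-linear) if either $F$ is standard (resp. linear), or there is a decomposition $\mathbb C^{r',s',t'}=A\oplus B$ into nonzero subspaces with $\langle a,b\rangle_{r',s',t'}=0$ for all $a\in A,b\in B$ such that $\pi_A\circ F$ is standard (resp. linear) and $\pi_B\circ F$ is null, where $\pi_A:\mathbb P^{r',s',t'}\dashrightarrow\mathbb PA$, $\pi_B:\mathbb P^{r',s',t'}\dashrightarrow\mathbb PB$ are induced by the linear projections, and $\mathbb PA,\mathbb PB$ carry the restricted forms. *)

theory Defs
  imports "HOL-Analysis.Analysis"
begin

text \<open>
  C^{r,s,t}: complex vectors indexed by a finite type 'n, with a signature
  function sg :: 'n => int taking values in {1,-1,0}; r, s, t are the numbers
  of indices with sign 1, -1, 0 respectively (diagonal form, coordinates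
  ordered arbitrarily -- this differs from the paper's ordering only by a
  coordinate permutation, which is an isometry).
\<close>

definition is_sig :: "('n::finite \<Rightarrow> int) \<Rightarrow> bool" where
  "is_sig sg \<longleftrightarrow> (\<forall>i. sg i \<in> {1, -1, 0})"

definition sig_r :: "('n::finite \<Rightarrow> int) \<Rightarrow> nat" where
  "sig_r sg = card {i. sg i = 1}"
definition sig_s :: "('n::finite \<Rightarrow> int) \<Rightarrow> nat" where
  "sig_s sg = card {i. sg i = -1}"
definition sig_t :: "('n::finite \<Rightarrow> int) \<Rightarrow> nat" where
  "sig_t sg = card {i. sg i = 0}"

definition hform :: "('n::finite \<Rightarrow> int) \<Rightarrow> complex^'n \<Rightarrow> complex^'n \<Rightarrow> complex" where
  "hform sg z w = (\<Sum>i\<in>UNIV. of_int (sg i) * z$i * cnj (w$i))"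

definition pt :: "complex^'n \<Rightarrow> (complex^'n) set" where
  "pt z = {c *s z | c. c \<noteq> 0}"

definition PS :: "(complex^'n) set set" where
  "PS = {pt z | z. z \<noteq> 0}"

definition proj_top :: "(complex^'n) set topology" where
  "proj_top = topology (\<lambda>S. S \<subseteq> PS \<and> open {z. z \<noteq> 0 \<and> pt z \<in> S})"

lemma istopology_proj: "istopology (\<lambda>S::(complex^'n) set set. S \<subseteq> PS \<and> open {z. z \<noteq> 0 \<and> pt z \<in> S})"
proof -
  have 1: "S \<inter> T \<subseteq> PS \<and> open {z. z \<noteq> 0 \<and> pt z \<in> S \<inter> T}"
    if a: "S \<subseteq> PS \<and> open {z. z \<noteq> 0 \<and> pt z \<in> S}" and b: "T \<subseteq> PS \<and> open {z. z \<noteq> 0 \<and> pt z \<in> T}"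
    for S T :: "(complex^'n) set set"
  proof -
    have eq: "{z. z \<noteq> 0 \<and> pt z \<in> S \<inter> T} = {z. z \<noteq> 0 \<and> pt z \<in> S} \<inter> {z. z \<noteq> 0 \<and> pt z \<in> T}" by auto
    have "open {z. z \<noteq> 0 \<and> pt z \<in> S \<inter> T}" unfolding eq using a b by (intro open_Int) auto
    then show ?thesis using a b by blast
  qed
  have 2: "\<Union>K \<subseteq> PS \<and> open {z. z \<noteq> 0 \<and> pt z \<in> \<Union>K}"
    if H: "\<forall>S\<in>K. S \<subseteq> PS \<and> open {z. z \<noteq> 0 \<and> pt z \<in> S}" for K :: "(complex^'n) set set set"
  proof -
    have eq: "{z. z \<noteq> 0 \<and> pt z \<in> \<Union>K} = (\<Union>S\<in>K. {z. z \<noteq> 0 \<and> pt z \<in> S})" by auto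
    have "open {z. z \<noteq> 0 \<and> pt z \<in> \<Union>K}" unfolding eq using H by (intro open_UN) auto
    then show ?thesis using H by blast
  qed
  show ?thesis unfolding istopology_def using 1 2 by blast
qed

lemma openin_proj_top: "openin proj_top S \<longleftrightarrow> S \<subseteq> PS \<and> open {z. z \<noteq> 0 \<and> pt z \<in> S}"
  unfolding proj_top_def by (simp add: istopology_proj)

definition point_pos :: "('n::finite \<Rightarrow> int) \<Rightarrow> (complex^'n) set \<Rightarrow> bool" where
  "point_pos sg p \<longleftrightarrow> (\<exists>z. z \<noteq> 0 \<and> p = pt z \<and> Re (hform sg z z) > 0)"
definition point_neg :: "('n::finite \<Rightarrow> int) \<Rightarrow> (complex^'n) set \<Rightarrow> bool" where
  "point_neg sg p \<longleftrightarrow> (\<exists>z. z \<noteq> 0 \<and> p = pt z \<and> Re (hform sg z z) < 0)"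
definition point_null :: "('n::finite \<Rightarrow> int) \<Rightarrow> (complex^'n) set \<Rightarrow> bool" where
  "point_null sg p \<longleftrightarrow> (\<exists>z. z \<noteq> 0 \<and> p = pt z \<and> hform sg z z = 0)"

definition porth :: "('n::finite \<Rightarrow> int) \<Rightarrow> (complex^'n) set \<Rightarrow> (complex^'n) set \<Rightarrow> bool" where
  "porth sg p q \<longleftrightarrow> (\<exists>z w. z \<noteq> 0 \<and> w \<noteq> 0 \<and> p = pt z \<and> q = pt w \<and> hform sg z w = 0)"

definition clin :: "(complex^'n \<Rightarrow> complex^'m) \<Rightarrow> bool" where
  "clin L \<longleftrightarrow> (\<forall>x y. L (x + y) = L x + L y) \<and> (\<forall>c x. L (c *s x) = c *s L x)"

definition csubspace :: "(complex^'m) set \<Rightarrow> bool" where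
  "csubspace H \<longleftrightarrow> 0 \<in> H \<and> (\<forall>x\<in>H. \<forall>y\<in>H. x + y \<in> H) \<and> (\<forall>c. \<forall>x\<in>H. c *s x \<in> H)"

definition cholo_on :: "(complex^'n) set \<Rightarrow> (complex^'n \<Rightarrow> complex^'m) \<Rightarrow> bool" where
  "cholo_on V g \<longleftrightarrow> (\<forall>w\<in>V. \<exists>D. (g has_derivative D) (at w) \<and> (\<forall>c x. D (c *s x) = c *s D x))"

definition proj_holo :: "(complex^'n) set set \<Rightarrow> ((complex^'n) set \<Rightarrow> (complex^'m) set) \<Rightarrow> bool" where
  "proj_holo U F \<longleftrightarrow> (\<forall>p\<in>U. F p \<in> PS) \<and>
     (\<forall>z. z \<noteq> 0 \<longrightarrow> pt z \<in> U \<longrightarrow>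
        (\<exists>V g. open V \<and> z \<in> V \<and> V \<subseteq> {w. w \<noteq> 0 \<and> pt w \<in> U} \<and> cholo_on V g \<and>
               (\<forall>w\<in>V. g w \<noteq> 0 \<and> F (pt w) = pt (g w))))"

definition local_orth_map ::
  "('n::finite \<Rightarrow> int) \<Rightarrow> ('m::finite \<Rightarrow> int) \<Rightarrow> (complex^'n) set set \<Rightarrow> ((complex^'n) set \<Rightarrow> (complex^'m) set) \<Rightarrow> bool" where
  "local_orth_map sg sg' U F \<longleftrightarrow> proj_holo U F \<and>
     (\<forall>p\<in>U. \<forall>q\<in>U. porth sg p q \<longrightarrow> porth sg' (F p) (F q))"

text \<open>The (possibly partially defined) map  p |-> [Pi w]  where F p = [w], agrees with the
  rational map induced by L (wherever both are defined), and is defined somewhere on U.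
  With Pr = id this is "F extends to the rational map induced by L".\<close>
definition agrees_with ::
  "(complex^'n) set set \<Rightarrow> ((complex^'n) set \<Rightarrow> (complex^'m) set) \<Rightarrow> (complex^'m \<Rightarrow> complex^'m)
    \<Rightarrow> (complex^'n \<Rightarrow> complex^'m) \<Rightarrow> bool" where
  "agrees_with U F Pr L \<longleftrightarrow> clin L \<and> (\<exists>z. L z \<noteq> 0) \<and>
     (\<exists>z w. z \<noteq> 0 \<and> pt z \<in> U \<and> F (pt z) = pt w \<and> Pr w \<noteq> 0) \<and>
     (\<forall>z w. z \<noteq> 0 \<longrightarrow> pt z \<in> U \<longrightarrow> F (pt z) = pt w \<longrightarrow> Pr w \<noteq> 0 \<longrightarrow> L z \<noteq> 0 \<longrightarrow>
        pt (Pr w) = pt (L z))"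

definition isometry ::
  "('n::finite \<Rightarrow> int) \<Rightarrow> ('m::finite \<Rightarrow> int) \<Rightarrow> (complex^'n \<Rightarrow> complex^'m) \<Rightarrow> bool" where
  "isometry sg sg' L \<longleftrightarrow> clin L \<and> (\<forall>u v. hform sg' (L u) (L v) = hform sg u v)"

definition linear_pmap ::
  "(complex^'n) set set \<Rightarrow> ((complex^'n) set \<Rightarrow> (complex^'m) set) \<Rightarrow> bool" where
  "linear_pmap U F \<longleftrightarrow> (\<exists>L. agrees_with U F id L)"

definition standard_pmap ::
  "('n::finite \<Rightarrow> int) \<Rightarrow> ('m::finite \<Rightarrow> int) \<Rightarrow> (complex^'n) set set \<Rightarrow> ((complex^'n) set \<Rightarrow> (complex^'m) set) \<Rightarrow> bool" where
  "standard_pmap sg sg' U F \<longleftrightarrow> (\<exists>L. isometry sg sg' L \<and> agrees_with U F id L)"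

definition null_space :: "('m::finite \<Rightarrow> int) \<Rightarrow> (complex^'m) set \<Rightarrow> bool" where
  "null_space sg' H \<longleftrightarrow> csubspace H \<and> (\<forall>x\<in>H. \<forall>y\<in>H. hform sg' x y = 0)"

definition null_pmap ::
  "('m::finite \<Rightarrow> int) \<Rightarrow> (complex^'n) set set \<Rightarrow> ((complex^'n) set \<Rightarrow> (complex^'m) set) \<Rightarrow> bool" where
  "null_pmap sg' U F \<longleftrightarrow> (\<exists>H. null_space sg' H \<and> (\<forall>p\<in>U. F p \<subseteq> H))"

definition orth_decomp :: "('m::finite \<Rightarrow> int) \<Rightarrow> (complex^'m) set \<Rightarrow> (complex^'m) set \<Rightarrow> bool" where
  "orth_decomp sg' A B \<longleftrightarrow> csubspace A \<and> csubspace B \<and> A \<noteq> {0} \<and> B \<noteq> {0} \<and>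
     A \<inter> B = {0} \<and> (\<forall>w. \<exists>a\<in>A. \<exists>b\<in>B. w = a + b) \<and>
     (\<forall>a\<in>A. \<forall>b\<in>B. hform sg' a b = 0)"

definition proj_on :: "(complex^'m) set \<Rightarrow> (complex^'m) set \<Rightarrow> complex^'m \<Rightarrow> complex^'m" where
  "proj_on A B w = (THE a. a \<in> A \<and> (\<exists>b\<in>B. w = a + b))"

definition proj_null ::
  "('m::finite \<Rightarrow> int) \<Rightarrow> (complex^'m) set \<Rightarrow> (complex^'m) set \<Rightarrow> (complex^'n) set set
    \<Rightarrow> ((complex^'n) set \<Rightarrow> (complex^'m) set) \<Rightarrow> bool" where
  "proj_null sg' A B U F \<longleftrightarrow> (\<exists>H. null_space sg' H \<and> H \<subseteq> B \<and>
     (\<forall>z w. z \<noteq> 0 \<longrightarrow> pt z \<in> U \<longrightarrow> F (pt z) = pt w \<longrightarrow> proj_on B A w \<noteq> 0 \<longrightarrow>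
        proj_on B A w \<in> H))"

definition quasi_linear ::
  "('m::finite \<Rightarrow> int) \<Rightarrow> (complex^'n) set set \<Rightarrow> ((complex^'n) set \<Rightarrow> (complex^'m) set) \<Rightarrow> bool" where
  "quasi_linear sg' U F \<longleftrightarrow> linear_pmap U F \<or>
     (\<exists>A B. orth_decomp sg' A B \<and>
        (\<exists>L. (\<forall>z. L z \<in> A) \<and> agrees_with U F (proj_on A B) L) \<and>
        proj_null sg' A B U F)"

definition quasi_standard ::
  "('n::finite \<Rightarrow> int) \<Rightarrow> ('m::finite \<Rightarrow> int) \<Rightarrow> (complex^'n) set set \<Rightarrow> ((complex^'n) set \<Rightarrow> (complex^'m) set) \<Rightarrow> bool" where
  "quasi_standard sg sg' U F \<longleftrightarrow> standard_pmap sg sg' U F \<or>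
     (\<exists>A B. orth_decomp sg' A B \<and>
        (\<exists>L. isometry sg sg' L \<and> (\<forall>z. L z \<in> A) \<and> agrees_with U F (proj_on A B) L) \<and>
        proj_null sg' A B U F)"

end

theory Submission
  imports Defs "HOL-Complex_Analysis.Conformal_Mappings"
begin

text \<open>
  Write \<open>H\<close> and \<open>K\<close> for the source and target forms and let \<open>f\<close> be a local holomorphic lift of the map; changing the
  sign of \<open>K\<close> if necessary, \<open>K\<close> has at most \<open>min r s\<close> negative squares.  Differentiating the orthogonality relation
  at a null point \<open>p\<close> gives \<open>K (f p) (Df p v) = c p * H p v\<close>.

  If \<open>c\<close> vanishes at all null points, then \<open>f p\<close> and \<open>Df p (p\<^sup>\<bottom>)\<close> span null spaces, which are too small for
  \<open>Df p\<close> to be injective on \<open>p\<^sup>\<bottom>\<close> modulo \<open>p\<close>; moving \<open>p\<close> in a kernel direction shows inductively that \<open>K (f p) (f w)\<close>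
  vanishes to infinite order along \<open>p\<^sup>\<bottom>\<close>, so the map is null.

  If \<open>c p \<noteq> 0\<close>, a correction \<open>T\<close> of \<open>Df p\<close> is conformal with factor \<open>c p\<close>.  By the bound on the signature, \<open>K\<close> is positive
  semidefinite on the orthogonal complement of the image of \<open>T\<close>, which forces \<open>f\<close> to be proportional to \<open>T\<close> on
  \<open>p\<^sup>\<bottom>\<close> modulo the radical.  Orthogonality to these values leaves, for general \<open>z\<close>, only
  \<open>f z = \<alpha> (T z + \<beta> T p) / c + n\<close> with \<open>n\<close> orthogonal to the image of \<open>T\<close>, and \<open>z \<mapsto> (H z p, \<beta>, n)\<close> is, after scaling, an orthogonal map
  into a space with a single negative square.  Since \<open>r, s \<ge> 2\<close>, such a map is null, which makes \<open>f\<close> projectively linear.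
\<close>

section \<open>Hermitian forms\<close>

lemma hform_add_left: "hform sg (x + y) z = hform sg x z + hform sg y z"
  and hform_add_right: "hform sg z (x + y) = hform sg z x + hform sg z y"
  and hform_diff_left: "hform sg (x - y) z = hform sg x z - hform sg y z"
  and hform_diff_right: "hform sg z (x - y) = hform sg z x - hform sg z y"
  by (simp_all add: hform_def algebra_simps sum.distrib sum_subtractf)

lemma hform_scale_left: "hform sg (c *s x) y = c * hform sg x y"
  and hform_scale_right: "hform sg x (c *s y) = cnj c * hform sg x y"
  by (simp_all add: hform_def sum_distrib_left algebra_simps)

lemma of_real_vector_scale: "complex_of_real a *s x = a *\<^sub>R x"
  unfolding vec_eq_iff by (metis scaleR_conv_of_real vector_scaleR_component vector_smult_component)

lemma hform_scaleR_left: "hform sg (a *\<^sub>R x) y = of_real a * hform sg x y"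
  and hform_scaleR_right: "hform sg x (a *\<^sub>R y) = of_real a * hform sg x y"
  by (simp_all add: of_real_vector_scale[symmetric] hform_scale_left hform_scale_right)

lemma hform_zero_left [simp]: "hform sg 0 y = 0"
  and hform_zero_right [simp]: "hform sg x 0 = 0"
  by (simp_all add: hform_def)

lemma hform_minus_left: "hform sg (- x) y = - hform sg x y"
  and hform_minus_right: "hform sg x (- y) = - hform sg x y"
  by (simp_all add: hform_def sum_negf)

lemmas hform_simps = hform_add_left hform_add_right hform_diff_left hform_diff_right
  hform_scale_left hform_scale_right hform_scaleR_left hform_scaleR_right
  hform_minus_left hform_minus_right

lemma cnj_hform: "cnj (hform sg x y) = hform sg y x"
  by (simp add: hform_def algebra_simps)

lemma hform_eq_0_commute: "hform sg x y = 0 \<longleftrightarrow> hform sg y x = 0"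
  by (metis cnj_hform complex_cnj_zero_iff)

lemma hform_self_sum: "hform sg x x = of_real (\<Sum>i\<in>UNIV. of_int (sg i) * (norm (x$i))\<^sup>2)"
  unfolding hform_def of_real_sum
  by (intro sum.cong refl) (simp add: complex_norm_square mult.assoc del: of_real_power)

lemma hform_self_real: "hform sg x x = of_real (Re (hform sg x x))"
  by (simp add: hform_self_sum)

lemma hform_uminus_sign: "hform (\<lambda>i. - sg i) x y = - hform sg x y"
  by (simp add: hform_def sum_negf)

lemma bounded_bilinear_hform: "bounded_bilinear (hform sg)"
  unfolding bilinear_conv_bounded_bilinear[symmetric] bilinear_def linear_iff
  by (auto simp: hform_simps scaleR_conv_of_real[of _ "hform _ _ _"])

lemmas tendsto_hform [tendsto_intros] = bounded_bilinear.tendsto[OF bounded_bilinear_hform]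
lemmas continuous_hform [continuous_intros] = bounded_bilinear.continuous[OF bounded_bilinear_hform]
lemmas continuous_on_hform [continuous_intros] = bounded_bilinear.continuous_on[OF bounded_bilinear_hform]

text \<open>Stated through coordinates, so that membership can be extended by the identity theorem
  one coordinate at a time.\<close>

definition radical :: "('n::finite \<Rightarrow> int) \<Rightarrow> (complex^'n) set" where
  "radical sg = {x. \<forall>i. sg i \<noteq> 0 \<longrightarrow> x$i = 0}"

lemma hform_radical_left: "x \<in> radical sg \<Longrightarrow> hform sg x y = 0"
  unfolding hform_def radical_def by (intro sum.neutral) auto

lemma hform_radical_right: "x \<in> radical sg \<Longrightarrow> hform sg y x = 0"
  unfolding hform_def radical_def by (intro sum.neutral) auto

lemma radical_add: "x \<in> radical sg \<Longrightarrow> y \<in> radical sg \<Longrightarrow> x + y \<in> radical sg"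
  and radical_scale: "x \<in> radical sg \<Longrightarrow> c *s x \<in> radical sg"
  by (auto simp: radical_def)

lemma radical_scale_iff: "c \<noteq> 0 \<Longrightarrow> c *s x \<in> radical sg \<longleftrightarrow> x \<in> radical sg"
  by (auto simp: radical_def)

text \<open>Pairing \<open>x\<close> with its image makes the form positive semidefinite, and the
  image has the same square as \<open>x\<close>. So a null vector outside the radical and its image
  form a hyperbolic pair up to scaling.\<close>

definition sign_flip :: "('n::finite \<Rightarrow> int) \<Rightarrow> complex^'n \<Rightarrow> complex^'n" where
  "sign_flip sg x = (\<chi> i. of_int (sg i) * x$i)"

lemma hform_sign_flip:
  assumes "is_sig sg" shows "hform sg x (sign_flip sg x) = of_real (\<Sum>i | sg i \<noteq> 0. (norm (x$i))\<^sup>2)"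
proof -
  have "hform sg x (sign_flip sg x) = (\<Sum>i\<in>UNIV. if sg i \<noteq> 0 then of_real ((norm (x$i))\<^sup>2) else 0)"
    unfolding hform_def
  proof (intro sum.cong refl)
    fix i
    have "sg i \<in> {1, -1, 0}" using assms by (auto simp: is_sig_def)
    then show "of_int (sg i) * x $ i * cnj (sign_flip sg x $ i)
        = (if sg i \<noteq> 0 then of_real ((norm (x$i))\<^sup>2) else 0)"
      by (auto simp: sign_flip_def complex_norm_square simp del: of_real_power)
  qed
  also have "\<dots> = (\<Sum>i | sg i \<noteq> 0. of_real ((norm (x$i))\<^sup>2))"
    by (simp add: sum.If_cases)
  finally show ?thesis by simp
qed

lemma hform_sign_flip_pos:
  assumes "is_sig sg" "x \<notin> radical sg"
  obtains t where "t > 0" "hform sg x (sign_flip sg x) = of_real t"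
proof
  show "hform sg x (sign_flip sg x) = of_real (\<Sum>i | sg i \<noteq> 0. (norm (x$i))\<^sup>2)"
    by (rule hform_sign_flip[OF assms(1)])
  obtain i where i: "sg i \<noteq> 0" "x$i \<noteq> 0" using assms(2) by (auto simp: radical_def)
  show "(\<Sum>i | sg i \<noteq> 0. (norm (x$i))\<^sup>2) > 0"
    by (rule sum_pos2[of _ i]) (use i in auto)
qed

lemma hform_sign_flip_flip:
  assumes "is_sig sg" shows "hform sg (sign_flip sg x) (sign_flip sg x) = hform sg x x"
  unfolding hform_def
proof (intro sum.cong refl)
  fix i
  have "sg i \<in> {1, -1, 0}" using assms by (auto simp: is_sig_def)
  then show "of_int (sg i) * sign_flip sg x $ i * cnj (sign_flip sg x $ i)
        = of_int (sg i) * x $ i * cnj (x $ i)"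
    by (auto simp: sign_flip_def)
qed

text \<open>Without negative coordinates the square is a sum of nonnegative terms. Dimension counts
  produce such vectors; this is how the bound on the number of negative squares enters.\<close>

lemma in_radical_if_no_negative_part:
  assumes "is_sig sg" "\<And>i. sg i = -1 \<Longrightarrow> x$i = 0" "Re (hform sg x x) \<le> 0"
  shows "x \<in> radical sg"
proof -
  have nn: "of_int (sg i) * (norm (x$i))\<^sup>2 \<ge> 0" for i
  proof -
    have "sg i \<in> {1, -1, 0}" using assms by (auto simp: is_sig_def)
    then show ?thesis using assms(2)[of i] by auto
  qed
  have "(\<Sum>i\<in>UNIV. of_int (sg i) * (norm (x$i))\<^sup>2) \<le> 0"
    using assms(3) by (simp add: hform_self_sum)
  then have "(\<Sum>i\<in>UNIV. of_int (sg i) * (norm (x$i))\<^sup>2) = 0"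
    using nn by (simp add: sum_nonneg antisym)
  then have "\<forall>i\<in>UNIV. of_int (sg i) * (norm (x$i))\<^sup>2 = 0"
    by (subst (asm) sum_nonneg_eq_0_iff) (use nn in auto)
  then show ?thesis by (auto simp: radical_def)
qed

lemma hform_axis: "hform sg (axis i c) x = of_int (sg i) * c * cnj (x$i)"
proof -
  have "hform sg (axis i c) x = (\<Sum>k\<in>UNIV. if k = i then of_int (sg i) * c * cnj (x$i) else 0)"
    unfolding hform_def by (intro sum.cong refl) (auto simp: axis_def)
  then show ?thesis by simp
qed

section \<open>Hyperbolic pairs with orthogonal unit vectors of both signs\<close>

lemma unit_kernel_vector:
  fixes u v :: complex
  obtains \<alpha> \<beta> where "\<alpha> * u + \<beta> * v = 0" "\<alpha> * cnj \<alpha> + \<beta> * cnj \<beta> = 1"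
proof (cases "u = 0 \<and> v = 0")
  case True
  show ?thesis by (rule that[of 1 0]) (use True in auto)
next
  case False
  define N where "N = sqrt ((norm u)\<^sup>2 + (norm v)\<^sup>2)"
  have pos: "(norm u)\<^sup>2 + (norm v)\<^sup>2 > 0" using False
    by (metis add_pos_nonneg add_nonneg_pos zero_le_power2 zero_less_norm_iff zero_less_power)
  then have N: "N > 0" and N2: "N * N = (norm u)\<^sup>2 + (norm v)\<^sup>2"
    unfolding N_def by (auto simp: real_sqrt_mult_self)
  show ?thesis
  proof (rule that[of "v / of_real N" "- u / of_real N"])
    show "v / of_real N * u + - u / of_real N * v = 0" by (simp add: field_simps)
    have "v / of_real N * cnj (v / of_real N) + - u / of_real N * cnj (- u / of_real N)
       = (v * cnj v + u * cnj u) / (of_real (N * N))"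
      by (simp add: add_divide_distrib)
    also have "v * cnj v + u * cnj u = of_real (N * N)"
      unfolding N2 by (simp add: complex_norm_square[symmetric] add.commute)
    finally show "v / of_real N * cnj (v / of_real N) + - u / of_real N * cnj (- u / of_real N) = 1"
      using N by simp
  qed
qed

text \<open>In the plane of two coordinates of equal sign, orthogonality to \<open>p\<close> and to
  \<open>sign_flip sg p\<close> is the same single equation, so a unit solution remains.\<close>

lemma witt_frame_sign:
  assumes "is_sig sg" "i \<noteq> j" "sg i = e" "sg j = e" "e \<in> {1, -1}"
  obtains a where "hform sg a p = 0" "hform sg a (sign_flip sg p) = 0" "hform sg a a = of_int e"
    "\<And>b. (\<And>k. sg k = e \<Longrightarrow> b$k = 0) \<Longrightarrow> hform sg a b = 0" "\<And>k. sg k \<noteq> e \<Longrightarrow> a$k = 0"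
proof -
  obtain \<alpha> \<beta> where ab: "\<alpha> * cnj (p$i) + \<beta> * cnj (p$j) = 0" "\<alpha> * cnj \<alpha> + \<beta> * cnj \<beta> = 1"
    by (rule unit_kernel_vector)
  define a where "a = axis i \<alpha> + axis j \<beta>"
  have h: "hform sg a x = of_int e * (\<alpha> * cnj (x$i) + \<beta> * cnj (x$j))" for x
    using assms by (simp add: a_def hform_simps hform_axis algebra_simps)
  have ai: "a$i = \<alpha>" "a$j = \<beta>" using assms(2) by (auto simp: a_def axis_def)
  show ?thesis
  proof (rule that[of a])
    show "hform sg a p = 0" by (simp add: h ab)
    have "hform sg a (sign_flip sg p) = of_int e * of_int e * (\<alpha> * cnj (p$i) + \<beta> * cnj (p$j))"
      using assms by (simp add: h sign_flip_def algebra_simps)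
    then show "hform sg a (sign_flip sg p) = 0" by (simp add: ab)
    show "hform sg a a = of_int e" by (simp add: h ai ab)
    show "hform sg a b = 0" if "\<And>k. sg k = e \<Longrightarrow> b$k = 0" for b
      using that assms by (simp add: h)
    show "a$k = 0" if "sg k \<noteq> e" for k using that assms by (auto simp: a_def axis_def)
  qed
qed

lemma card_ge_2_obtain:
  assumes "card A \<ge> 2" obtains i j where "i \<in> A" "j \<in> A" "i \<noteq> j"
  using assms by (metis card_2_iff' obtain_subset_with_card_n subset_iff)

text \<open>The hyperbolic plane of \<open>p\<close> and \<open>y\<close> uses up one positive and
  one negative square; the bounds \<open>r, s \<ge> 2\<close> leave room for \<open>a\<close> and
  \<open>b\<close>, whose sum and difference are null directions orthogonal to
  \<open>p\<close>.\<close>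

locale witt_frame =
  fixes sg :: "'n::finite \<Rightarrow> int" and p y a b :: "complex^'n"
  assumes h_pp: "hform sg p p = 0" and h_py: "hform sg p y = 1" and h_yy: "hform sg y y = 0"
    and h_ap: "hform sg a p = 0" and h_ay: "hform sg a y = 0" and h_aa: "hform sg a a = 1"
    and h_bp: "hform sg b p = 0" and h_by: "hform sg b y = 0" and h_bb: "hform sg b b = -1"
    and h_ab: "hform sg a b = 0"
begin

lemma frame_sym: "hform sg y p = 1" "hform sg p a = 0" "hform sg y a = 0"
  "hform sg p b = 0" "hform sg y b = 0" "hform sg b a = 0"
  using h_py h_ap h_ay h_bp h_by h_ab hform_eq_0_commute[of sg] by (auto simp: cnj_hform[symmetric, of sg y p])

lemmas frame = h_pp h_py h_yy h_ap h_ay h_aa h_bp h_by h_bb h_ab frame_sym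

lemma not_radical: "p \<notin> radical sg"
  using h_py hform_radical_left[of p sg y] by auto

end

lemma witt_frame_exists:
  assumes sg: "is_sig sg" and r: "sig_r sg \<ge> 2" and s: "sig_s sg \<ge> 2"
    and pp: "hform sg p p = 0" and p: "p \<notin> radical sg"
  obtains y a b where "witt_frame sg p y a b"
proof -
  obtain i j where ij: "i \<noteq> j" "sg i = 1" "sg j = 1"
    using card_ge_2_obtain[OF r[unfolded sig_r_def]] by (metis mem_Collect_eq)
  obtain k l where kl: "k \<noteq> l" "sg k = -1" "sg l = -1"
    using card_ge_2_obtain[OF s[unfolded sig_s_def]] by (metis mem_Collect_eq)
  obtain a where a: "hform sg a p = 0" "hform sg a (sign_flip sg p) = 0" "hform sg a a = of_int 1"
    "\<And>b. (\<And>k. sg k = 1 \<Longrightarrow> b$k = 0) \<Longrightarrow> hform sg a b = 0"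
    by (rule witt_frame_sign[OF sg ij, where p=p]) auto
  obtain b where b: "hform sg b p = 0" "hform sg b (sign_flip sg p) = 0" "hform sg b b = of_int (-1)"
    "\<And>k. sg k \<noteq> -1 \<Longrightarrow> b$k = 0"
    by (rule witt_frame_sign[OF sg kl, where p=p]) auto
  obtain t where t: "t > 0" "hform sg p (sign_flip sg p) = of_real t"
    using hform_sign_flip_pos[OF sg p] by blast
  \<comment> \<open>\<open>y\<close> is the sign flip of \<open>p\<close>, scaled to pair to 1 with
    it; \<open>a\<close> and \<open>b\<close> are orthogonal because they live on coordinates of
    opposite signs.\<close>
  have "witt_frame sg p ((1 / t) *\<^sub>R sign_flip sg p) a b"
  proof
    show "hform sg p p = 0" by (rule pp)
    show "hform sg p ((1 / t) *\<^sub>R sign_flip sg p) = 1"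
      using t by (simp add: hform_simps)
    show "hform sg ((1 / t) *\<^sub>R sign_flip sg p) ((1 / t) *\<^sub>R sign_flip sg p) = 0"
      by (simp add: hform_simps hform_sign_flip_flip[OF sg] pp)
    show "hform sg a b = 0" using a(4) b(4) by (metis one_neq_neg_one)
  qed (use a b in \<open>auto simp: hform_simps\<close>)
  then show ?thesis by (rule that)
qed

section \<open>Linear systems\<close>

lemma clin_imp_linear:
  assumes "clin L" shows "Vector_Spaces.linear (*s) (*s) L"
  using assms unfolding clin_def
  by unfold_locales (auto simp: vec.scale_right_distrib vec.scale_left_distrib)

text \<open>Padding the functionals with zero rows gives an endomorphism that misses a basis vector,
  so it is not injective either. Using a set of functionals reduces each dimension count to a bound
  on \<open>card K\<close>.\<close>

lemma underdetermined_system: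
  fixes K :: "(complex^'a::finite \<Rightarrow> complex) set"
  assumes "finite K" "card K < CARD('a)"
    and add: "\<And>\<phi> x y. \<phi> \<in> K \<Longrightarrow> \<phi> (x + y) = \<phi> x + \<phi> y"
    and scale: "\<And>\<phi> c x. \<phi> \<in> K \<Longrightarrow> \<phi> (c *s x) = c * \<phi> x"
  obtains x where "x \<noteq> 0" "\<And>\<phi>. \<phi> \<in> K \<Longrightarrow> \<phi> x = 0"
proof -
  obtain \<iota> :: "(complex^'a \<Rightarrow> complex) \<Rightarrow> 'a" where \<iota>: "inj_on \<iota> K" "\<iota> ` K \<subseteq> UNIV"
    using card_le_inj[of K "UNIV::'a set"] assms(1,2) by auto
  have "card (\<iota> ` K) < CARD('a)" using assms(2) \<iota> by (simp add: card_image)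
  then obtain i0 where i0: "i0 \<notin> \<iota> ` K" by (metis UNIV_eq_I less_irrefl)
  define g where "g x = (\<chi> i. if i \<in> \<iota> ` K then inv_into K \<iota> i x else 0)" for x
  have mem: "inv_into K \<iota> i \<in> K" if "i \<in> \<iota> ` K" for i using that by (rule inv_into_into)
  have "clin g" unfolding clin_def g_def vec_eq_iff using add scale mem by auto
  then have lin: "Vector_Spaces.linear (*s) (*s) g" by (rule clin_imp_linear)
  have "g x \<noteq> axis i0 1" for x
  proof
    assume "g x = axis i0 1"
    then have "g x $ i0 = 1" by (simp add: axis_def)
    then show False using i0 by (simp add: g_def)
  qed
  then have "\<not> surj g" by (metis surj_def)
  then have "\<not> inj g" using vec.linear_inj_imp_surj[OF lin] by blast
  then obtain x where x: "x \<noteq> 0" "g x = 0" using vec.linear_inj_iff_eq_0[OF lin] by blast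
  show ?thesis
  proof (rule that[OF x(1)])
    fix \<phi> assume \<phi>: "\<phi> \<in> K"
    then have "g x $ \<iota> \<phi> = \<phi> x" using \<iota> by (simp add: g_def)
    then show "\<phi> x = 0" using x by simp
  qed
qed

section \<open>Scalar holomorphic functions of several variables\<close>

definition holo_scalar :: "(complex^'n::finite) set \<Rightarrow> (complex^'n \<Rightarrow> complex) \<Rightarrow> bool" where
  "holo_scalar B h \<longleftrightarrow> (\<forall>z\<in>B. \<exists>D. (h has_derivative D) (at z) \<and> (\<forall>c x. D (c *s x) = c * D x))"

lemma holo_scalar_const: "holo_scalar B (\<lambda>z. c)"
  unfolding holo_scalar_def by (auto intro!: exI[of _ "\<lambda>_. 0"] derivative_eq_intros)

lemma holo_scalar_add:
  assumes "holo_scalar B f" "holo_scalar B g" shows "holo_scalar B (\<lambda>z. f z + g z)"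
  unfolding holo_scalar_def
proof
  fix z assume "z \<in> B"
  then obtain D E where "(f has_derivative D) (at z)" "\<forall>c x. D (c *s x) = c * D x"
     "(g has_derivative E) (at z)" "\<forall>c x. E (c *s x) = c * E x"
    using assms unfolding holo_scalar_def by meson
  then show "\<exists>D. ((\<lambda>z. f z + g z) has_derivative D) (at z) \<and> (\<forall>c x. D (c *s x) = c * D x)"
    by (intro exI[of _ "\<lambda>x. D x + E x"]) (auto intro!: has_derivative_add simp: algebra_simps)
qed

lemma holo_scalar_mult:
  assumes "holo_scalar B f" "holo_scalar B g" shows "holo_scalar B (\<lambda>z. f z * g z)"
  unfolding holo_scalar_def
proof
  fix z assume "z \<in> B"
  then obtain D E where "(f has_derivative D) (at z)" "\<forall>c x. D (c *s x) = c * D x"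
     "(g has_derivative E) (at z)" "\<forall>c x. E (c *s x) = c * E x"
    using assms unfolding holo_scalar_def by meson
  then show "\<exists>D. ((\<lambda>z. f z * g z) has_derivative D) (at z) \<and> (\<forall>c x. D (c *s x) = c * D x)"
    by (intro exI[of _ "\<lambda>x. f z * E x + D x * g z"])
      (auto intro!: has_derivative_mult simp: distrib_left mult.assoc mult.left_commute)
qed

lemma holo_scalar_diff:
  assumes "holo_scalar B f" "holo_scalar B g" shows "holo_scalar B (\<lambda>z. f z - g z)"
  using holo_scalar_add[OF assms(1) holo_scalar_mult[OF holo_scalar_const[of B "-1"] assms(2)]] by simp

lemma holo_scalar_inverse:
  assumes "holo_scalar B f" "\<And>z. z \<in> B \<Longrightarrow> f z \<noteq> 0" shows "holo_scalar B (\<lambda>z. inverse (f z))"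
  unfolding holo_scalar_def
proof
  fix z assume z: "z \<in> B"
  then obtain D where "(f has_derivative D) (at z)" "\<forall>c x. D (c *s x) = c * D x"
    using assms unfolding holo_scalar_def by meson
  then show "\<exists>D. ((\<lambda>z. inverse (f z)) has_derivative D) (at z) \<and> (\<forall>c x. D (c *s x) = c * D x)"
    using assms(2)[OF z]
    by (intro exI[of _ "\<lambda>x. - (inverse (f z) * D x * inverse (f z))"]) (auto intro!: has_derivative_inverse)
qed

lemma holo_scalar_divide:
  assumes "holo_scalar B f" "holo_scalar B g" "\<And>z. z \<in> B \<Longrightarrow> g z \<noteq> 0"
  shows "holo_scalar B (\<lambda>z. f z / g z)"
  using holo_scalar_mult[OF assms(1) holo_scalar_inverse[OF assms(2,3)]] by (simp add: divide_inverse)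

lemma holo_scalar_clin:
  fixes \<phi> :: "complex^'m::finite \<Rightarrow> complex" and f :: "complex^'n::finite \<Rightarrow> complex^'m"
  assumes "cholo_on B f" "bounded_linear \<phi>" "\<And>c x. \<phi> (c *s x) = c * \<phi> x"
  shows "holo_scalar B (\<lambda>z. \<phi> (f z))"
  unfolding holo_scalar_def
proof
  fix z assume z: "z \<in> B"
  then obtain D where "(f has_derivative D) (at z)" "\<forall>c x. D (c *s x) = c *s D x"
    using assms unfolding cholo_on_def by meson
  then show "\<exists>D. ((\<lambda>z. \<phi> (f z)) has_derivative D) (at z) \<and> (\<forall>c x. D (c *s x) = c * D x)"
    using assms(3) by (intro exI[of _ "\<lambda>x. \<phi> (D x)"]) (auto intro!: bounded_linear.has_derivative[OF assms(2)])
qed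

lemma cholo_on_id: "cholo_on B (\<lambda>z. z)"
  unfolding cholo_on_def by (auto intro!: exI[of _ "\<lambda>x. x"])

lemma bounded_linear_hform_left: "bounded_linear (\<lambda>x. hform sg x w)"
  by (rule bounded_bilinear.bounded_linear_left[OF bounded_bilinear_hform])

lemma holo_scalar_hform: "cholo_on B f \<Longrightarrow> holo_scalar B (\<lambda>z. hform sg (f z) w)"
  by (rule holo_scalar_clin[OF _ bounded_linear_hform_left]) (auto simp: hform_simps)

lemma holo_scalar_nth: "cholo_on B f \<Longrightarrow> holo_scalar B (\<lambda>z. f z $ i)"
  by (rule holo_scalar_clin[OF _ bounded_linear_vec_nth]) auto

lemma cholo_on_subset: "cholo_on B f \<Longrightarrow> A \<subseteq> B \<Longrightarrow> cholo_on A f"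
  unfolding cholo_on_def by blast

lemma bounded_linear_clin: "clin L \<Longrightarrow> bounded_linear L"
  unfolding linear_conv_bounded_linear[symmetric] linear_iff clin_def
  by (auto simp: of_real_vector_scale[symmetric])

lemma cholo_on_clin: "clin L \<Longrightarrow> cholo_on B L"
  unfolding cholo_on_def
  by (metis bounded_linear_clin bounded_linear_imp_has_derivative clin_def)

lemma holo_scalar_continuous_on: "holo_scalar B h \<Longrightarrow> continuous_on B h"
  unfolding holo_scalar_def
  by (metis continuous_at_imp_continuous_on has_derivative_continuous)

lemma cholo_on_continuous_on: "cholo_on B h \<Longrightarrow> continuous_on B h"
  unfolding cholo_on_def
  by (metis continuous_at_imp_continuous_on has_derivative_continuous)

section \<open>Restriction to complex lines and sets of uniqueness\<close>

lemma bounded_linear_scale_left: "bounded_linear (\<lambda>c::complex. c *s (v::complex^'n::finite))"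
  unfolding linear_conv_bounded_linear[symmetric] linear_iff
  by (auto simp: vec_eq_iff algebra_simps)

lemma holo_scalar_line:
  assumes "holo_scalar B h" "open B"
  shows "(\<lambda>\<zeta>. h (x + \<zeta> *s v)) holomorphic_on {\<zeta>. x + \<zeta> *s v \<in> B}"
proof (rule holomorphic_onI)
  fix \<zeta> assume "\<zeta> \<in> {\<zeta>. x + \<zeta> *s v \<in> B}"
  then obtain D where D: "(h has_derivative D) (at (x + \<zeta> *s v))" "\<forall>c x. D (c *s x) = c * D x"
    using assms unfolding holo_scalar_def by blast
  have "((\<lambda>\<zeta>. x + \<zeta> *s v) has_derivative (\<lambda>\<zeta>. \<zeta> *s v)) (at \<zeta>)"
    by (auto intro!: derivative_eq_intros bounded_linear_imp_has_derivative bounded_linear_scale_left)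
  from diff_chain_at[OF this, of h D] D
  have "((\<lambda>\<zeta>. h (x + \<zeta> *s v)) has_derivative (\<lambda>\<zeta>. D v * \<zeta>)) (at \<zeta>)"
    by (simp add: o_def mult.commute)
  then show "(\<lambda>\<zeta>. h (x + \<zeta> *s v)) field_differentiable at \<zeta> within {\<zeta>. x + \<zeta> *s v \<in> B}"
    unfolding field_differentiable_def
    using has_field_derivative_at_within has_field_derivative_def by blast
qed

lemma continuous_on_line: "continuous_on S (\<lambda>\<zeta>::complex. x + \<zeta> *s (v::complex^'n::finite))"
  by (intro continuous_intros linear_continuous_on bounded_linear_scale_left)

lemma open_line: "open B \<Longrightarrow> open {\<zeta>::complex. x + \<zeta> *s (v::complex^'n::finite) \<in> B}"
  using open_vimage[OF _ continuous_on_line[of UNIV x v], of B] by (simp add: vimage_def)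

lemma convex_line:
  assumes "convex B" shows "convex {\<zeta>::complex. x + \<zeta> *s (v::complex^'n::finite) \<in> B}"
proof (rule convexI)
  fix \<zeta> \<eta> :: complex and s t :: real
  assume h: "\<zeta> \<in> {\<zeta>. x + \<zeta> *s v \<in> B}" "\<eta> \<in> {\<zeta>. x + \<zeta> *s v \<in> B}" "0 \<le> s" "0 \<le> t" "s + t = 1"
  have "s *\<^sub>R (x + \<zeta> *s v) + t *\<^sub>R (x + \<eta> *s v) \<in> B"
    using convexD[OF assms] h by simp
  moreover have "s *\<^sub>R (x + \<zeta> *s v) + t *\<^sub>R (x + \<eta> *s v) = (s + t) *\<^sub>R x + (s *\<^sub>R \<zeta> + t *\<^sub>R \<eta>) *s v"
    by (simp add: vec_eq_iff algebra_simps scaleR_conv_of_real[where 'a=complex])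
  ultimately show "s *\<^sub>R \<zeta> + t *\<^sub>R \<eta> \<in> {\<zeta>. x + \<zeta> *s v \<in> B}" using h by simp
qed

text \<open>A convex domain meets each complex line in a convex, hence connected, set, so the
  identity theorem in one variable applies.\<close>

lemma holo_scalar_zero_line:
  assumes "holo_scalar B h" "open B" "convex B"
    and "q \<in> B" "q + \<eta> *s v \<in> B"
    and lim: "0 islimpt {\<zeta>. q + \<zeta> *s v \<in> B \<and> h (q + \<zeta> *s v) = 0}"
  shows "h (q + \<eta> *s v) = 0"
  by (rule analytic_continuation[OF holo_scalar_line[OF assms(1,2), of q v] open_line[OF assms(2)]
          convex_connected[OF convex_line[OF assms(3)]],
          of "{\<zeta>. q + \<zeta> *s v \<in> B \<and> h (q + \<zeta> *s v) = 0}" 0 \<eta>])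
     (use assms in auto)

lemma islimpt_line:
  assumes "open B" "q \<in> B" "0 islimpt S"
  shows "0 islimpt {\<zeta>::complex. q + \<zeta> *s (v::complex^'n::finite) \<in> B} \<inter> S"
proof (rule islimptI)
  fix T assume T: "(0::complex) \<in> T" "open T"
  have "open (T \<inter> {\<zeta>. q + \<zeta> *s v \<in> B})" by (intro open_Int T open_line assms(1))
  from islimptE[OF assms(3) _ this] T assms(2)
  show "\<exists>\<eta>\<in>{\<zeta>. q + \<zeta> *s v \<in> B} \<inter> S. \<eta> \<in> T \<and> \<eta> \<noteq> 0" by auto
qed

lemma holo_scalar_zero_open:
  assumes "holo_scalar B h" "open B" "convex B" "open O'" "O' \<subseteq> B" "q \<in> O'"
    and "\<And>z. z \<in> O' \<Longrightarrow> h z = 0" and "z \<in> B"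
  shows "h z = 0"
proof -
  have "open {\<zeta>. q + \<zeta> *s (z - q) \<in> O'}" by (rule open_line[OF assms(4)])
  then have "0 islimpt {\<zeta>. q + \<zeta> *s (z - q) \<in> O'}"
    by (intro interior_limit_point) (use assms(6) in \<open>auto simp: interior_open\<close>)
  then have "0 islimpt {\<zeta>. q + \<zeta> *s (z - q) \<in> B \<and> h (q + \<zeta> *s (z - q)) = 0}"
    by (rule islimpt_subset) (use assms(5,7) in auto)
  then have "h (q + 1 *s (z - q)) = 0"
    by (intro holo_scalar_zero_line[OF assms(1-3)]) (use assms in auto)
  then show ?thesis by simp
qed

text \<open>The null points of a complex line through a null point \<open>q\<close>, transversal to the null cone there, form a circle
  (or a real line) through \<open>q\<close>; its points are parametrised by \<open>Re (1 / s) = const\<close>.\<close>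

lemma null_points_on_line_accumulate:
  assumes q: "hform sg q q = 0" and k: "hform sg v q \<noteq> 0"
  shows "0 islimpt {\<zeta>. hform sg (q + \<zeta> *s v) (q + \<zeta> *s v) = 0}"
proof -
  define k where "k = hform sg v q"
  define h where "h = Re (hform sg v v)"
  have hv: "hform sg v v = of_real h" unfolding h_def by (rule hform_self_real)
  \<comment> \<open>For \<open>\<zeta> = cnj k * s\<close> the null condition, divided by the
    squared moduli of \<open>k\<close> and \<open>s\<close>, reads
    \<open>1 / s + cnj (1 / s) = - h\<close>. It fixes only the real part of \<open>1 / s\<close>;
    the imaginary part may tend to infinity.\<close>
  define s where "s n = 1 / Complex (- h / 2) (real (Suc n))" for n
  have nz: "Complex (- h / 2) (real (Suc n)) \<noteq> 0" for n by (simp add: complex_eq_iff)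
  have seq: "cnj k * s n \<in> {\<zeta>. hform sg (q + \<zeta> *s v) (q + \<zeta> *s v) = 0} - {0}" for n
  proof -
    define c where "c = Complex (- h / 2) (real (Suc n))"
    have c: "c \<noteq> 0" "c + cnj c = - of_real h" using nz[of n] by (auto simp: c_def complex_eq_iff)
    have sn: "s n = 1 / c" by (simp add: s_def c_def)
    have "hform sg (q + (cnj k * s n) *s v) (q + (cnj k * s n) *s v)
       = cnj k * s n * k + k * cnj (s n) * cnj k + cnj k * s n * (k * cnj (s n)) * of_real h"
      using q by (simp add: hform_simps hv k_def cnj_hform algebra_simps)
    also have "\<dots> = k * cnj k / (c * cnj c) * (cnj c + c + of_real h)"
      using c(1) unfolding sn by (simp add: divide_simps) (simp add: algebra_simps)
    also have "cnj c + c + of_real h = 0" using c(2) by (simp add: add.commute)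
    finally show ?thesis using k c(1) by (simp add: k_def sn)
  qed
  have "filterlim (\<lambda>n. Complex (- h / 2) (real (Suc n))) at_infinity sequentially"
    unfolding filterlim_at_infinity_conv_norm_at_top
  proof (rule filterlim_at_top_mono)
    show "filterlim (\<lambda>n. real (Suc n)) at_top sequentially"
      by (metis filterlim_Suc filterlim_compose filterlim_real_sequentially)
    show "\<forall>\<^sub>F n in sequentially. real (Suc n) \<le> norm (Complex (- h / 2) (real (Suc n)))"
      by (rule always_eventually) (metis abs_Im_le_cmod complex.sel(2) abs_of_nat)
  qed
  then have "s \<longlonglongrightarrow> 0"
    unfolding s_def by (intro tendsto_divide_0[OF tendsto_const])
  then have "(\<lambda>n. cnj k * s n) \<longlonglongrightarrow> 0" by (rule tendsto_mult_right_zero)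
  then show ?thesis using seq unfolding islimpt_sequential
    by (intro exI[of _ "\<lambda>n. cnj k * s n"]) blast
qed

text \<open>On a line through \<open>q\<close> transversal to the null cone the null points
  accumulate at \<open>q\<close>, so \<open>h\<close> vanishes on that line; the remaining points
  are limits of such points along \<open>v\<close>.\<close>

lemma zero_on_null_points:
  assumes h: "holo_scalar B h" and B: "open B" "convex B" and V: "csubspace V"
    and q: "q \<in> V" "q \<in> B" "hform sg q q = 0" and v: "v \<in> V" "hform sg v q \<noteq> 0"
    and zero: "\<And>z. z \<in> V \<Longrightarrow> z \<in> B \<Longrightarrow> hform sg z z = 0 \<Longrightarrow> h z = 0"
    and z: "z \<in> V" "z \<in> B"
  shows "h z = 0"
proof -
  have lin: "x + c *s w \<in> V" if "x \<in> V" "w \<in> V" for x w c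
    using that V by (auto simp: csubspace_def)
  have lin': "x - w \<in> V" if "x \<in> V" "w \<in> V" for x w
    using lin[OF that, of "-1"] by simp
  have main: "h x = 0" if x: "x \<in> V" "x \<in> B" "hform sg (x - q) q \<noteq> 0" for x
  proof -
    have "0 islimpt {\<zeta>. q + \<zeta> *s (x - q) \<in> B} \<inter> {\<zeta>. hform sg (q + \<zeta> *s (x - q)) (q + \<zeta> *s (x - q)) = 0}"
      by (rule islimpt_line[OF B(1) q(2) null_points_on_line_accumulate[OF q(3) x(3)]])
    then have "0 islimpt {\<zeta>. q + \<zeta> *s (x - q) \<in> B \<and> h (q + \<zeta> *s (x - q)) = 0}"
      by (rule islimpt_subset) (use zero lin[OF q(1) lin'[OF x(1) q(1)]] in auto)
    then have "h (q + 1 *s (x - q)) = 0"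
      by (intro holo_scalar_zero_line[OF h B]) (use q x in auto)
    then show ?thesis by simp
  qed
  show ?thesis
  proof (cases "hform sg (z - q) q = 0")
    case False then show ?thesis using main z by blast
  next
    case True
    \<comment> \<open>The line from \<open>q\<close> to \<open>z\<close> is not transversal; adding
      a nonzero multiple of \<open>v\<close> to \<open>z\<close> makes it so.\<close>
    have "0 islimpt - {0::complex}"
      by (simp add: islimpt_punctured islimpt_UNIV Compl_eq_Diff_UNIV flip: islimpt_punctured)
    then have "0 islimpt {\<zeta>. z + \<zeta> *s v \<in> B} \<inter> - {0}" by (rule islimpt_line[OF B(1) z(2)])
    then have "0 islimpt {\<zeta>. z + \<zeta> *s v \<in> B \<and> h (z + \<zeta> *s v) = 0}"
    proof (rule islimpt_subset, intro subsetI)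
      fix \<zeta> assume "\<zeta> \<in> {\<zeta>. z + \<zeta> *s v \<in> B} \<inter> -{0}"
      then have \<zeta>: "z + \<zeta> *s v \<in> B" "\<zeta> \<noteq> 0" by auto
      have "hform sg (z + \<zeta> *s v - q) q = \<zeta> * hform sg v q"
        using True by (simp add: hform_simps)
      then show "\<zeta> \<in> {\<zeta>. z + \<zeta> *s v \<in> B \<and> h (z + \<zeta> *s v) = 0}"
        using main[of "z + \<zeta> *s v"] \<zeta> z v lin by auto
    qed
    then have "h (z + 0 *s v) = 0"
      by (intro holo_scalar_zero_line[OF h B]) (use z in auto)
    then show ?thesis by simp
  qed
qed

section \<open>First order consequences of orthogonality\<close>

lemma card_signature:
  fixes sg :: "'n::finite \<Rightarrow> int"
  assumes "is_sig sg" shows "CARD('n) = sig_r sg + sig_s sg + sig_t sg"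
proof -
  have U: "(UNIV::'n set) = ({i. sg i = 1} \<union> {i. sg i = -1}) \<union> {i. sg i = 0}"
    using assms by (auto simp: is_sig_def)
  have "card ({i. sg i = 1} \<union> {i. sg i = -1}) = sig_r sg + sig_s sg"
    unfolding sig_r_def sig_s_def by (rule card_Un_disjoint) auto
  moreover have "card (({i. sg i = 1} \<union> {i. sg i = -1}) \<union> {i. sg i = 0})
      = card ({i. sg i = 1} \<union> {i. sg i = -1}) + sig_t sg"
    unfolding sig_t_def by (rule card_Un_disjoint) auto
  ultimately show ?thesis unfolding U by simp
qed

lemma vector_derivative_eventually_0:
  fixes \<psi> :: "real \<Rightarrow> 'a::real_normed_vector"
  assumes "(\<psi> has_vector_derivative d) (at 0)" "\<forall>\<^sub>F t in nhds 0. \<psi> t = 0"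
  shows "d = 0"
proof -
  obtain S where S: "open S" "0 \<in> S" "\<And>t. t \<in> S \<Longrightarrow> \<psi> t = 0"
    using assms(2) unfolding eventually_nhds by blast
  have "((\<lambda>t. 0) has_vector_derivative d) (at (0::real))"
    by (rule has_vector_derivative_transform_within_open[OF assms(1) S(1,2)]) (use S in auto)
  then show ?thesis using vector_derivative_unique_at[of "\<lambda>_. 0" d 0 0] has_vector_derivative_const by blast
qed

text \<open>A lift over a convex chart. Two bounds in \<open>s_le\<close> serve the two possible
  signs of the conformal factor: a positive factor sends negative vectors to negative ones, a
  negative factor sends positive vectors there.\<close>

locale local_orth =
  fixes sg :: "'n::finite \<Rightarrow> int" and sg' :: "'m::finite \<Rightarrow> int"
    and B :: "(complex^'n) set" and f :: "complex^'n \<Rightarrow> complex^'m"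
    and Df :: "complex^'n \<Rightarrow> complex^'n \<Rightarrow> complex^'m"
  assumes sg: "is_sig sg" and sg': "is_sig sg'"
    and r2: "sig_r sg \<ge> 2" and s2: "sig_s sg \<ge> 2"
    and s_le: "sig_s sg' \<le> sig_r sg" "sig_s sg' \<le> sig_s sg"
    and open_B: "open B" and convex_B: "convex B"
    and deriv_f: "z \<in> B \<Longrightarrow> (f has_derivative Df z) (at z)"
    and Df_scale: "z \<in> B \<Longrightarrow> Df z (c *s x) = c *s Df z x"
    and orth: "z \<in> B \<Longrightarrow> w \<in> B \<Longrightarrow> hform sg z w = 0 \<Longrightarrow> hform sg' (f z) (f w) = 0"
begin

abbreviation H where "H \<equiv> hform sg"
abbreviation K where "K \<equiv> hform sg'"

lemma cholo_f: "cholo_on B f"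
  unfolding cholo_on_def using deriv_f Df_scale by blast

lemma bounded_linear_Df: "z \<in> B \<Longrightarrow> bounded_linear (Df z)"
  using deriv_f has_derivative_bounded_linear by blast

lemma Df_simps:
  assumes "z \<in> B"
  shows "Df z (x + y) = Df z x + Df z y" "Df z (x - y) = Df z x - Df z y" "Df z (c *s x) = c *s Df z x"
    "Df z (t *\<^sub>R x) = t *\<^sub>R Df z x" "Df z 0 = 0"
  using bounded_linear_Df[OF assms] Df_scale[OF assms]
  by (auto simp: linear_simps)

lemma f_curve:
  assumes "(q has_vector_derivative u) (at 0)" "q 0 = p" "p \<in> B"
  shows "((\<lambda>t. f (q t)) has_vector_derivative Df p u) (at 0)"
proof -
  have "(f has_derivative Df p) (at (q 0))" using deriv_f assms by simp
  from diff_chain_at[OF assms(1)[unfolded has_vector_derivative_def] this] show ?thesis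
    unfolding has_vector_derivative_def by (simp add: o_def Df_simps[OF assms(3)])
qed

lemma curve_in_B:
  assumes "(q has_vector_derivative u) (at (0::real))" "q 0 \<in> S" "open S"
  shows "\<forall>\<^sub>F t in nhds 0. q t \<in> S"
proof -
  have "continuous (at 0) q" using assms(1) has_vector_derivative_continuous by blast
  then have "\<forall>\<^sub>F t in at 0. q t \<in> S"
    using assms(2,3) unfolding continuous_at tendsto_def by blast
  then show ?thesis using assms(2) by (metis (mono_tags, lifting) eventually_nhds_conv_at)
qed

lemma line_deriv: "((\<lambda>t. p + t *\<^sub>R v) has_vector_derivative v) (at (0::real))"
  by (auto intro!: derivative_eq_intros)

text \<open>Along \<open>p + t *\<^sub>R v\<close> orthogonality to \<open>z\<close> persists;
  differentiate \<open>K (f z) (f (p + t *\<^sub>R v)) = 0\<close> at \<open>t = 0\<close>.\<close>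

lemma orth_deriv:
  assumes z: "z \<in> B" and p: "p \<in> B" and zp: "H z p = 0" and zv: "H z v = 0"
  shows "K (f z) (Df p v) = 0"
proof -
  have "((\<lambda>t. K (f z) (f (p + t *\<^sub>R v))) has_vector_derivative (K (f z) (Df p v) + K 0 (f (p + 0 *\<^sub>R v)))) (at 0)"
    by (rule bounded_bilinear.has_vector_derivative[OF bounded_bilinear_hform has_vector_derivative_const f_curve])
       (use p in \<open>auto intro!: line_deriv\<close>)
  moreover have "\<forall>\<^sub>F t in nhds 0. K (f z) (f (p + t *\<^sub>R v)) = 0"
    using curve_in_B[OF line_deriv[of p v] _ open_B]
    by (rule eventually_mono) (use p z zp zv in \<open>auto intro!: orth simp: hform_simps\<close>)
  ultimately show ?thesis by (auto dest: vector_derivative_eventually_0)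
qed

text \<open>By \<open>orth_deriv\<close>, the functional given by \<open>K (f z)\<close> and
  \<open>Df p\<close> kills the kernel of \<open>H z\<close>, so the two are proportional. The
  cross-multiplied form can be differentiated in \<open>z\<close>.\<close>

lemma orth_deriv_proportional:
  assumes z: "z \<in> B" and p: "p \<in> B" and zp: "H z p = 0"
  shows "K (f z) (Df p v) * H z w = K (f z) (Df p w) * H z v"
proof -
  have "K (f z) (Df p (H w z *s v - H v z *s w)) = 0"
    by (rule orth_deriv[OF assms]) (simp add: hform_simps cnj_hform)
  then show ?thesis using p by (simp add: Df_simps hform_simps cnj_hform algebra_simps)
qed

text \<open>\<open>scale_at\<close> is the candidate for the conformal factor of
  \<open>Df p\<close>; \<open>defect\<close> records how far \<open>Df p\<close> is from multiplying
  products with \<open>y\<close> by that factor.\<close>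

definition scale_at where "scale_at p y = K (f p) (Df p y)"
definition defect where "defect p y u = K (Df p u) (Df p y) - scale_at p y * H u y"

lemma point_vs_deriv:
  assumes p: "p \<in> B" and "H p p = 0" and y: "H p y = 1"
  shows "K (f p) (Df p v) = scale_at p y * H p v"
  using orth_deriv_proportional[OF p p assms(2), of v y] y by (simp add: scale_at_def)

lemma point_point: "p \<in> B \<Longrightarrow> H p p = 0 \<Longrightarrow> K (f p) (f p) = 0"
  using orth by blast

text \<open>Differentiate the proportionality relation at \<open>z = p + t *\<^sub>R u\<close>,
  which stays orthogonal to \<open>p\<close>. If \<open>v\<close> is orthogonal to \<open>p\<close>
  too, the defect drops out.\<close>

lemma deriv_vs_deriv:
  assumes p: "p \<in> B" and pp: "H p p = 0" and y: "H p y = 1" and u: "H u p = 0"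
  shows "K (Df p u) (Df p v) = defect p y u * H p v + scale_at p y * H u v"
proof -
  define \<psi> where "\<psi> t = K (f (p + t *\<^sub>R u)) (Df p v) * H (p + t *\<^sub>R u) y
      - K (f (p + t *\<^sub>R u)) (Df p y) * H (p + t *\<^sub>R u) v" for t :: real
  have K': "((\<lambda>t. K (f (p + t *\<^sub>R u)) w) has_vector_derivative (K (f (p + 0 *\<^sub>R u)) 0 + K (Df p u) w)) (at 0)" for w
    by (rule bounded_bilinear.has_vector_derivative[OF bounded_bilinear_hform f_curve has_vector_derivative_const])
       (use p in \<open>auto intro!: line_deriv\<close>)
  have H': "((\<lambda>t. H (p + t *\<^sub>R u) w) has_vector_derivative (H (p + 0 *\<^sub>R u) 0 + H u w)) (at 0)" for w
    by (rule bounded_bilinear.has_vector_derivative[OF bounded_bilinear_hform line_deriv has_vector_derivative_const])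
  have "(\<psi> has_vector_derivative
     ((K (f (p + 0 *\<^sub>R u)) (Df p v) * (H (p + 0 *\<^sub>R u) 0 + H u y) + (K (f (p + 0 *\<^sub>R u)) 0 + K (Df p u) (Df p v)) * H (p + 0 *\<^sub>R u) y)
     - (K (f (p + 0 *\<^sub>R u)) (Df p y) * (H (p + 0 *\<^sub>R u) 0 + H u v) + (K (f (p + 0 *\<^sub>R u)) 0 + K (Df p u) (Df p y)) * H (p + 0 *\<^sub>R u) v))) (at 0)"
    unfolding \<psi>_def by (intro has_vector_derivative_diff has_vector_derivative_mult K' H')
  moreover have "\<forall>\<^sub>F t in nhds 0. \<psi> t = 0"
    using curve_in_B[OF line_deriv[of p u] _ open_B]
  proof (rule eventually_mono)
    show "p + 0 *\<^sub>R u \<in> B" using p by simp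
    fix t assume "p + t *\<^sub>R u \<in> B"
    then show "\<psi> t = 0" unfolding \<psi>_def
      using orth_deriv_proportional[of "p + t *\<^sub>R u" p v y] p pp u by (simp add: hform_simps)
  qed
  ultimately have "K (f p) (Df p v) * H u y + K (Df p u) (Df p v) * H p y
     - (K (f p) (Df p y) * H u v + K (Df p u) (Df p y) * H p v) = 0"
    by (auto dest: vector_derivative_eventually_0)
  then show ?thesis using y point_vs_deriv[OF p pp y, of v]
    by (simp add: defect_def scale_at_def algebra_simps)
qed

section \<open>The degenerate case\<close>

text \<open>The \<open>m\<close>-th derivative along the complex line through \<open>w\<close> in
  direction \<open>y\<close>, assembled from one-variable derivatives so that limit theorems for
  holomorphic functions apply.\<close>

definition line_deriv_f :: "nat \<Rightarrow> complex^'n \<Rightarrow> complex^'n \<Rightarrow> complex^'m" where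
  "line_deriv_f m y w = (\<chi> i. (deriv ^^ m) (\<lambda>\<sigma>. f (w + \<sigma> *s y) $ i) 0)"

lemma line_deriv_f_0: "line_deriv_f 0 y w = f w"
  by (simp add: line_deriv_f_def vec_eq_iff)

lemma line_deriv_f_shift:
  "line_deriv_f m y (w + \<tau> *s y) $ i = (deriv ^^ m) (\<lambda>\<sigma>. f (w + \<sigma> *s y) $ i) \<tau>"
  unfolding line_deriv_f_def
  by (subst higher_deriv_shift_0[of m _ \<tau>]) (simp add: o_def vec.scale_left_distrib add.assoc)

lemma holomorphic_f_line: "(\<lambda>\<sigma>. f (w + \<sigma> *s y) $ i) holomorphic_on {\<sigma>. w + \<sigma> *s y \<in> B}"
  by (rule holo_scalar_line[OF holo_scalar_nth[OF cholo_f] open_B])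

lemma has_derivative_vec_components:
  fixes F :: "complex \<Rightarrow> complex^'k::finite"
  assumes "\<And>i. ((\<lambda>\<sigma>. F \<sigma> $ i) has_field_derivative d $ i) (at a)"
  shows "(F has_derivative (\<lambda>h. h *s d)) (at a)"
proof -
  have "((\<lambda>\<sigma>. \<Sum>i\<in>UNIV. F \<sigma> $ i *s axis i 1) has_derivative (\<lambda>h. \<Sum>i\<in>UNIV. (d $ i * h) *s axis i 1)) (at a)"
    by (intro has_derivative_sum bounded_linear.has_derivative[OF bounded_linear_scale_left]
        assms[unfolded has_field_derivative_def])
  moreover have "(\<Sum>i\<in>UNIV. (d $ i * h) *s axis i 1) = h *s d" for h
    using basis_expansion[of "h *s d"] by (simp add: mult.commute)
  ultimately show ?thesis by (simp add: basis_expansion)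
qed

lemma line_deriv_f_deriv:
  assumes "w + \<tau> *s y \<in> B"
  shows "((\<lambda>\<sigma>. line_deriv_f m y (w + \<sigma> *s y)) has_derivative (\<lambda>h. h *s line_deriv_f (Suc m) y (w + \<tau> *s y))) (at \<tau>)"
proof (rule has_derivative_vec_components)
  fix i
  have "(deriv ^^ m) (\<lambda>\<sigma>. f (w + \<sigma> *s y) $ i) holomorphic_on {\<sigma>. w + \<sigma> *s y \<in> B}"
    by (rule holomorphic_higher_deriv[OF holomorphic_f_line open_line[OF open_B]])
  then show "((\<lambda>\<sigma>. line_deriv_f m y (w + \<sigma> *s y) $ i) has_field_derivative line_deriv_f (Suc m) y (w + \<tau> *s y) $ i) (at \<tau>)"
    unfolding line_deriv_f_shift funpow.simps o_apply
    by (rule holomorphic_derivI[OF _ open_line[OF open_B]]) (use assms in simp)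
qed

text \<open>On a compact ball \<open>f\<close> is uniformly continuous, so its restrictions to the
  parallel lines through \<open>x k\<close> converge uniformly on a disc, and hence so do their
  derivatives at the centre.\<close>

lemma line_deriv_f_continuous:
  assumes w: "w \<in> B" and lim: "x \<longlonglongrightarrow> w"
  shows "(\<lambda>k. line_deriv_f m y (x k)) \<longlonglongrightarrow> line_deriv_f m y w"
proof (rule vec_tendstoI)
  fix i
  obtain R where R: "R > 0" "cball w R \<subseteq> B" using open_B w open_contains_cball by blast
  \<comment> \<open>Half of \<open>R\<close> is left for the distance of \<open>x k\<close> from
    \<open>w\<close>; adding 1 avoids division by zero when \<open>y = 0\<close>.\<close>
  define \<rho> where "\<rho> = R / (2 * (norm y + 1))"
  have ny: "norm y + 1 > 0" by (simp add: add_nonneg_pos)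
  have \<rho>: "\<rho> > 0" unfolding \<rho>_def using R ny by simp
  have nb: "norm (c *s y) \<le> R / 2" if "c \<in> ball 0 \<rho>" for c :: complex
  proof -
    have "norm (c *s y) = norm c * norm y"
      by (simp add: norm_vec_def norm_mult L2_set_right_distrib)
    also have "\<dots> \<le> \<rho> * (norm y + 1)" using that \<rho> by (intro mult_mono) auto
    also have "\<dots> = R / 2" unfolding \<rho>_def using ny by (simp add: field_simps)
    finally show ?thesis .
  qed
  have uc: "uniformly_continuous_on (cball w R) f"
    by (intro compact_uniformly_continuous continuous_on_subset[OF cholo_on_continuous_on[OF cholo_f] R(2)]) simp
  have "uniform_limit (ball (0::complex) \<rho>) (\<lambda>k \<sigma>. f (x k + \<sigma> *s y) $ i) (\<lambda>\<sigma>. f (w + \<sigma> *s y) $ i) sequentially"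
  proof (rule uniform_limitI)
    fix e :: real assume "e > 0"
    then obtain d where d: "d > 0"
      "\<And>u v. u \<in> cball w R \<Longrightarrow> v \<in> cball w R \<Longrightarrow> dist v u < d \<Longrightarrow> dist (f v) (f u) < e"
      using uc unfolding uniformly_continuous_on_def by metis
    have "\<forall>\<^sub>F k in sequentially. dist (x k) w < min d (R / 2)"
      using lim d(1) R(1) by (intro tendstoD) auto
    then show "\<forall>\<^sub>F k in sequentially. \<forall>\<sigma>\<in>ball (0::complex) \<rho>. dist (f (x k + \<sigma> *s y) $ i) (f (w + \<sigma> *s y) $ i) < e"
    proof (rule eventually_mono, intro ballI)
      fix k \<sigma> assume k: "dist (x k) w < min d (R / 2)" and \<sigma>: "\<sigma> \<in> ball (0::complex) \<rho>"
      have 1: "w + \<sigma> *s y \<in> cball w R" using nb[OF \<sigma>] R(1) by (simp add: dist_norm)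
      have "norm (x k - w + \<sigma> *s y) \<le> norm (x k - w) + norm (\<sigma> *s y)" by (rule norm_triangle_ineq)
      also have "\<dots> \<le> R" using nb[OF \<sigma>] k by (simp add: dist_norm)
      finally have 2: "x k + \<sigma> *s y \<in> cball w R"
        by (simp add: dist_norm norm_minus_commute[of w] algebra_simps)
      have "dist (x k + \<sigma> *s y) (w + \<sigma> *s y) < d" using k by (simp add: dist_norm)
      from d(2)[OF 1 2 this] show "dist (f (x k + \<sigma> *s y) $ i) (f (w + \<sigma> *s y) $ i) < e"
        using dist_vec_nth_le order_le_less_trans by blast
    qed
  qed
  moreover have "\<forall>\<^sub>F k in sequentially. (\<lambda>\<sigma>. f (x k + \<sigma> *s y) $ i) holomorphic_on ball (0::complex) \<rho>"
  proof -
    have "\<forall>\<^sub>F k in sequentially. dist (x k) w < R / 2" using lim R(1) by (intro tendstoD) auto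
    then show ?thesis
    proof (rule eventually_mono)
      fix k assume k: "dist (x k) w < R / 2"
      show "(\<lambda>\<sigma>. f (x k + \<sigma> *s y) $ i) holomorphic_on ball 0 \<rho>"
      proof (rule holomorphic_on_subset[OF holomorphic_f_line], intro subsetI, unfold mem_Collect_eq)
        fix \<sigma> :: complex assume \<sigma>: "\<sigma> \<in> ball 0 \<rho>"
        have "norm (x k - w + \<sigma> *s y) \<le> norm (x k - w) + norm (\<sigma> *s y)" by (rule norm_triangle_ineq)
        also have "\<dots> \<le> R" using nb[OF \<sigma>] k by (simp add: dist_norm)
        finally have "x k + \<sigma> *s y \<in> cball w R"
          by (simp add: dist_norm norm_minus_commute[of w] algebra_simps)
        then show "x k + \<sigma> *s y \<in> B" using R by blast
      qed
    qed
  qed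
  ultimately show "(\<lambda>k. line_deriv_f m y (x k) $ i) \<longlonglongrightarrow> line_deriv_f m y w $ i"
    unfolding line_deriv_f_def vec_lambda_beta
    by (intro higher_deriv_complex_uniform_limit[where A = "ball 0 \<rho>"]) (use \<rho> in auto)
qed

text \<open>Count equations for \<open>u\<close> and \<open>\<alpha>\<close> together:
  \<open>sig_t sg\<close> for the radical coordinates, two for \<open>p\<close> and
  \<open>y\<close>, at most \<open>sig_s sg'\<close> for the negative coordinates of
  \<open>Df p u - \<alpha> *s f p\<close>. There are more unknowns. Degeneracy makes the resulting
  vector null, so it lies in the radical.\<close>

lemma tangent_kernel:
  assumes "witt_frame sg p y a b" and p: "p \<in> B"
    and degenerate: "\<And>v. K (f p) (Df p v) = 0"
    and fp: "f p \<notin> radical sg'"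
  obtains u \<alpha> where "u \<noteq> 0" "H u p = 0" "H u y = 0" "\<And>i. sg i = 0 \<Longrightarrow> u $ i = 0"
    "Df p u - \<alpha> *s f p \<in> radical sg'"
proof -
  interpret witt_frame sg p y a b by fact
  \<comment> \<open>The \<open>Some\<close> coordinates hold \<open>u\<close>, the additional
    \<open>None\<close> coordinate holds \<open>\<alpha>\<close>.\<close>
  define X where "X x = (\<chi> i. x $ Some i)" for x :: "complex^('n option)"
  have X: "X (x + x') = X x + X x'" "X (c *s x) = c *s X x" for x x' c
    by (auto simp: X_def vec_eq_iff)
  define K1 where "K1 = (\<lambda>i x. X x $ i) ` {i. sg i = 0}"
  define K2 where "K2 = {\<lambda>x. H (X x) p, \<lambda>x. H (X x) y}"
  define K3 where "K3 = (\<lambda>j x. Df p (X x) $ j - x $ None * f p $ j) ` {j. sg' j = -1}"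
  have fin: "finite (K1 \<union> K2 \<union> K3)" by (simp add: K1_def K2_def K3_def)
  have "card K1 \<le> sig_t sg" unfolding K1_def sig_t_def by (rule card_image_le) simp
  moreover have "card K2 \<le> 2" unfolding K2_def by (simp add: card_insert_if)
  moreover have "card K3 \<le> sig_s sg'" unfolding K3_def sig_s_def by (rule card_image_le) simp
  moreover have "card (K1 \<union> K2 \<union> K3) \<le> card K1 + card K2 + card K3"
    by (meson card_Un_le add_le_mono1 order_trans)
  moreover have "CARD('n option) = sig_r sg + sig_s sg + sig_t sg + 1"
    using card_signature[OF sg] by (simp add: card_UNIV_option)
  ultimately have "card (K1 \<union> K2 \<union> K3) < CARD('n option)" using r2 s2 s_le by linarith
  then obtain x where x: "x \<noteq> 0" "\<And>\<phi>. \<phi> \<in> K1 \<union> K2 \<union> K3 \<Longrightarrow> \<phi> x = 0"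
  proof (rule underdetermined_system[OF fin])
    fix \<phi> x x' assume "\<phi> \<in> K1 \<union> K2 \<union> K3"
    then show "\<phi> (x + x') = \<phi> x + \<phi> x'"
      using p by (auto simp: K1_def K2_def K3_def X hform_simps Df_simps algebra_simps)
  next
    fix \<phi> c x assume "\<phi> \<in> K1 \<union> K2 \<union> K3"
    then show "\<phi> (c *s x) = c * \<phi> x"
      using p by (auto simp: K1_def K2_def K3_def X hform_simps Df_simps algebra_simps)
  qed (use that in blast)
  define u where "u = X x"
  define \<alpha> where "\<alpha> = x $ None"
  have 1: "u $ i = 0" if "sg i = 0" for i
    using x(2)[of "\<lambda>x. X x $ i"] that by (auto simp: K1_def u_def)
  have 2: "H u p = 0" "H u y = 0"
    using x(2)[of "\<lambda>x. H (X x) p"] x(2)[of "\<lambda>x. H (X x) y"] by (auto simp: K2_def u_def)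
  have 3: "(Df p u - \<alpha> *s f p) $ j = 0" if "sg' j = -1" for j
    using x(2)[of "\<lambda>x. Df p (X x) $ j - x $ None * f p $ j"] that by (auto simp: K3_def u_def \<alpha>_def)
  have c: "scale_at p y = 0" using degenerate by (simp add: scale_at_def)
  have KK: "K (Df p u) (Df p u) = 0"
    using deriv_vs_deriv[OF p h_pp h_py 2(1), of u] 2 c by (simp add: hform_eq_0_commute[of sg p u])
  have "K (Df p u - \<alpha> *s f p) (Df p u - \<alpha> *s f p) = 0"
    using KK degenerate[of u] hform_eq_0_commute[of sg' "f p" "Df p u"] point_point[OF p h_pp]
    by (simp add: hform_simps)
  then have 4: "Df p u - \<alpha> *s f p \<in> radical sg'"
    by (intro in_radical_if_no_negative_part[OF sg']) (use 3 in auto)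
  \<comment> \<open>A solution with \<open>u = 0\<close> would put a nonzero multiple of
    \<open>f p\<close> into the radical.\<close>
  have "u \<noteq> 0"
  proof
    assume u: "u = 0"
    have "\<alpha> \<noteq> 0"
    proof
      assume "\<alpha> = 0"
      then have "x $ k = 0" for k
        using u by (cases k) (auto simp: u_def \<alpha>_def X_def vec_eq_iff)
      then show False using x(1) by (simp add: vec_eq_iff)
    qed
    moreover have "(- \<alpha>) *s f p \<in> radical sg'" using 4 u p by (simp add: Df_simps vec.scale_minus_left)
    ultimately show False using fp radical_scale_iff[of "- \<alpha>" "f p" sg'] by auto
  qed
  then show ?thesis using that 1 2 4 by blast
qed

lemma nonradical_eventually:
  assumes "\<forall>\<^sub>F t in nhds (0::real). H (q t) y \<noteq> 0"
  shows "\<forall>\<^sub>F t in nhds 0. q t \<notin> radical sg"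
  using assms by (rule eventually_mono) (auto simp: hform_radical_left)

text \<open>Moving \<open>q\<close> inside the null cone in the direction \<open>u\<close> of the kernel does not change \<open>f q\<close> to first order
  (up to scaling), but it does move the hyperplane orthogonal to \<open>q\<close>; hence the functional \<open>K (f q)\<close> kills
  derivatives of \<open>f\<close> of all orders along that hyperplane.\<close>

lemma degenerate_step:
  assumes IH: "\<And>q w. q \<in> B \<Longrightarrow> H q q = 0 \<Longrightarrow> q \<notin> radical sg \<Longrightarrow> w \<in> B \<Longrightarrow> H q w = 0 \<Longrightarrow> H q y \<noteq> 0
      \<Longrightarrow> K (f q) (line_deriv_f m y w) = 0"
    and wf: "witt_frame sg q y' a b" and q: "q \<in> B" and w: "w \<in> B" "H q w = 0" and qy: "H q y \<noteq> 0"
    and u: "H u q = 0" "H u y' = 0" "Df q u - \<alpha> *s f q \<in> radical sg'" and uw: "H u w \<noteq> 0"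
  shows "K (f q) (line_deriv_f (Suc m) y w) = 0"
proof -
  interpret witt_frame sg q y' a b by fact
  define h where "h = Re (H u u)"
  have huu: "H u u = of_real h" unfolding h_def by (rule hform_self_real)
  \<comment> \<open>A curve of null vectors with velocity \<open>u\<close>: since \<open>u\<close>
    is orthogonal to \<open>q\<close> and \<open>y'\<close>, the term along \<open>y'\<close>
    cancels the square of \<open>t *\<^sub>R u\<close>.\<close>
  define Q where "Q t = q + t *\<^sub>R u - (t\<^sup>2 * h / 2) *\<^sub>R y'" for t :: real
  have uq: "H q u = 0" "H y' u = 0" using u hform_eq_0_commute[of sg] by auto
  have Q_null: "H (Q t) (Q t) = 0" for t
    unfolding Q_def using u uq by (simp add: hform_simps frame huu power2_eq_square)
  have Qd: "(Q has_vector_derivative u) (at 0)"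
    unfolding Q_def by (auto intro!: derivative_eq_intros)
  have Q0: "Q 0 = q" by (simp add: Q_def)
  have HQ: "((\<lambda>t. H (Q t) x) has_vector_derivative H u x) (at 0)" for x
    using bounded_bilinear.has_vector_derivative[OF bounded_bilinear_hform[of sg] Qd has_vector_derivative_const[of x]]
    by simp
  \<comment> \<open>Chosen so that \<open>w + \<sigma> t *s y\<close> stays orthogonal to
    \<open>Q t\<close>.\<close>
  define \<sigma> where "\<sigma> t = - cnj (H (Q t) w / H (Q t) y)" for t
  define \<sigma>' where "\<sigma>' = - cnj (H u w / H q y)"
  have \<sigma>d: "(\<sigma> has_vector_derivative \<sigma>') (at 0)"
  proof -
    have "((\<lambda>t. H (Q t) w / H (Q t) y) has_derivative (\<lambda>t. t *\<^sub>R (H u w / H q y))) (at 0)"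
      by (rule derivative_eq_intros HQ[unfolded has_vector_derivative_def] refl)+
         (use qy w in \<open>auto simp: Q0 scaleR_conv_of_real field_simps\<close>)
    then have "((\<lambda>t. - cnj (H (Q t) w / H (Q t) y)) has_derivative (\<lambda>t. - cnj (t *\<^sub>R (H u w / H q y)))) (at 0)"
      by (intro has_derivative_minus bounded_linear.has_derivative[OF bounded_linear_cnj])
    then show ?thesis unfolding has_vector_derivative_def \<sigma>_def \<sigma>'_def by simp
  qed
  have \<sigma>0: "\<sigma> 0 = 0" using w by (simp add: \<sigma>_def Q0)
  define G where "G \<tau> = line_deriv_f m y (w + \<tau> *s y)" for \<tau>
  have Gd: "(G has_derivative (\<lambda>h. h *s line_deriv_f (Suc m) y w)) (at (\<sigma> 0))"
    using line_deriv_f_deriv[of w 0 y m] w(1) by (simp add: G_def[abs_def] \<sigma>0)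
  have G\<sigma>: "((\<lambda>t. G (\<sigma> t)) has_vector_derivative \<sigma>' *s line_deriv_f (Suc m) y w) (at 0)"
    using diff_chain_at[OF \<sigma>d[unfolded has_vector_derivative_def] Gd]
    unfolding has_vector_derivative_def o_def
    by (simp add: of_real_vector_scale[symmetric] scaleR_conv_of_real[where 'a=complex])
  have fQ: "((\<lambda>t. f (Q t)) has_vector_derivative Df q u) (at 0)" by (rule f_curve[OF Qd Q0 q])
  have "((\<lambda>t. K (f (Q t)) (G (\<sigma> t))) has_vector_derivative
      (K (f (Q 0)) (\<sigma>' *s line_deriv_f (Suc m) y w) + K (Df q u) (G (\<sigma> 0)))) (at 0)"
    by (rule bounded_bilinear.has_vector_derivative[OF bounded_bilinear_hform fQ G\<sigma>])
  moreover have "\<forall>\<^sub>F t in nhds 0. K (f (Q t)) (G (\<sigma> t)) = 0"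
  proof -
    have 1: "\<forall>\<^sub>F t in nhds 0. Q t \<in> B" by (rule curve_in_B[OF Qd _ open_B]) (simp add: Q0 q)
    have 2: "\<forall>\<^sub>F t in nhds 0. w + \<sigma> t *s y \<in> B"
      using curve_in_B[OF \<sigma>d _ open_line[OF open_B, of w y]] w(1) \<sigma>0 by simp
    have 3: "\<forall>\<^sub>F t in nhds 0. H (Q t) y \<noteq> 0"
      using curve_in_B[OF HQ[of y], of "- {0}"] qy Q0 by (simp add: open_Compl)
    show ?thesis using 1 2 3 nonradical_eventually[OF 3]
    proof eventually_elim
      case (elim t)
      have "H (Q t) (w + \<sigma> t *s y) = 0"
        using elim(3) by (simp add: hform_simps \<sigma>_def)
      then show ?case unfolding G_def by (intro IH Q_null) (use elim in auto)
    qed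
  qed
  ultimately have E: "cnj \<sigma>' * K (f q) (line_deriv_f (Suc m) y w) + K (Df q u) (line_deriv_f m y w) = 0"
    by (auto dest!: vector_derivative_eventually_0 simp: Q0 \<sigma>0 G_def hform_simps)
  \<comment> \<open>The second summand of \<open>E\<close> vanishes, as \<open>Df q u\<close> is a
    multiple of \<open>f q\<close> modulo the radical; \<open>\<sigma>' \<noteq> 0\<close> because
    \<open>H u w \<noteq> 0\<close>.\<close>
  have "K (Df q u) (line_deriv_f m y w) = K (Df q u - \<alpha> *s f q) (line_deriv_f m y w)
      + \<alpha> * K (f q) (line_deriv_f m y w)"
    by (simp add: hform_simps)
  also have "\<dots> = 0"
    using hform_radical_left[OF u(3)] IH[OF q h_pp not_radical w qy] by simp
  finally show ?thesis using E uw qy by (simp add: \<sigma>'_def)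
qed

text \<open>Induction on the order by \<open>degenerate_step\<close>, which asks for a kernel
  direction \<open>u\<close> not orthogonal to \<open>w\<close>. The exceptional \<open>w\<close>
  are limits of admissible ones, and the derivatives are continuous.\<close>

lemma degenerate_all_orders:
  assumes deg: "\<And>p v. p \<in> B \<Longrightarrow> H p p = 0 \<Longrightarrow> p \<notin> radical sg \<Longrightarrow> K (f p) (Df p v) = 0"
  shows "q \<in> B \<Longrightarrow> H q q = 0 \<Longrightarrow> q \<notin> radical sg \<Longrightarrow> w \<in> B \<Longrightarrow> H q w = 0 \<Longrightarrow> H q y \<noteq> 0
      \<Longrightarrow> K (f q) (line_deriv_f m y w) = 0"
proof (induction m arbitrary: q w)
  case 0
  then show ?case by (simp add: line_deriv_f_0 orth)
next
  case (Suc m)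
  obtain y' a b where wf: "witt_frame sg q y' a b"
    using witt_frame_exists[OF sg r2 s2 Suc.prems(2,3)] by blast
  interpret witt_frame sg q y' a b by fact
  show ?case
  proof (cases "f q \<in> radical sg'")
    case True then show ?thesis by (rule hform_radical_left)
  next
    case False
    obtain u \<alpha> where u: "u \<noteq> 0" "H u q = 0" "H u y' = 0" "\<And>i. sg i = 0 \<Longrightarrow> u $ i = 0"
      "Df q u - \<alpha> *s f q \<in> radical sg'"
      using tangent_kernel[OF wf Suc.prems(1) deg[OF Suc.prems(1-3)] False] by blast
    note step = degenerate_step[OF Suc.IH wf Suc.prems(1) _ _ Suc.prems(6) u(2,3,5)]
    have "u \<notin> radical sg" using u(1,4) by (auto simp: radical_def vec_eq_iff)
    then obtain t where t: "t > 0" "H u (sign_flip sg u) = of_real t"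
      using hform_sign_flip_pos[OF sg] by blast
    \<comment> \<open>The sign flip of \<open>u\<close> pairs with \<open>u\<close>; the multiple of
      \<open>y'\<close>, orthogonal to \<open>u\<close>, brings it into the complement of
      \<open>q\<close>.\<close>
    define w' where "w' = sign_flip sg u - cnj (H q (sign_flip sg u)) *s y'"
    have w': "H q w' = 0" "H u w' = of_real t"
      using t(2) u(3) by (simp_all add: w'_def hform_simps frame)
    show ?thesis
    proof (cases "H u w = 0")
      case False
      then show ?thesis using step Suc.prems by blast
    next
      case True
      define x where "x k = w + (1 / real (Suc k)) *\<^sub>R w'" for k
      have "x \<longlonglongrightarrow> w + 0 *\<^sub>R w'"
        unfolding x_def by (intro tendsto_intros) (use lim_1_over_n filterlim_Suc filterlim_compose in blast)
      then have x: "x \<longlonglongrightarrow> w" by simp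
      have "(\<lambda>k. K (f q) (line_deriv_f (Suc m) y (x k))) \<longlonglongrightarrow> K (f q) (line_deriv_f (Suc m) y w)"
        by (intro tendsto_intros line_deriv_f_continuous Suc.prems x)
      moreover have "\<forall>\<^sub>F k in sequentially. x k \<in> B"
        using x open_B Suc.prems(4) by (simp add: topological_tendstoD)
      then have "\<forall>\<^sub>F k in sequentially. K (f q) (line_deriv_f (Suc m) y (x k)) = 0"
      proof (rule eventually_mono)
        fix k assume "x k \<in> B"
        moreover have "H q (x k) = 0" using Suc.prems w' by (simp add: x_def hform_simps)
        moreover have "H u (x k) \<noteq> 0"
          using True w' t by (simp add: x_def hform_simps del: of_nat_Suc)
        ultimately show "K (f q) (line_deriv_f (Suc m) y (x k)) = 0" using step by blast
      qed
      then have "(\<lambda>k. K (f q) (line_deriv_f (Suc m) y (x k))) \<longlonglongrightarrow> 0"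
        by (rule tendsto_eventually)
      ultimately show ?thesis using LIMSEQ_unique by blast
    qed
  qed
qed

text \<open>On the line from \<open>q\<close> to \<open>x\<close> the product of \<open>f\<close>
  with \<open>f q\<close> vanishes at \<open>q\<close> together with all its derivatives, by
  \<open>degenerate_all_orders\<close> at \<open>w = q\<close>.\<close>

lemma degenerate_null:
  assumes deg: "\<And>p v. p \<in> B \<Longrightarrow> H p p = 0 \<Longrightarrow> p \<notin> radical sg \<Longrightarrow> K (f p) (Df p v) = 0"
    and q: "q \<in> B" "H q q = 0" "q \<notin> radical sg" and x: "x \<in> B"
  shows "K (f q) (f x) = 0"
proof (cases "H q x = 0")
  case True then show ?thesis using orth q x by blast
next
  case False
  define y where "y = x - q"
  have y: "H q y \<noteq> 0" using False q by (simp add: y_def hform_simps)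
  define S where "S = {\<sigma>. q + \<sigma> *s y \<in> B}"
  have S: "open S" "connected S" "0 \<in> S" "1 \<in> S"
    unfolding S_def by (rule open_line[OF open_B], rule convex_connected[OF convex_line[OF convex_B]])
      (use q x in \<open>auto simp: y_def\<close>)
  define g where "g m \<sigma> = K (line_deriv_f m y (q + \<sigma> *s y)) (f q)" for m \<sigma>
  have g: "(g m has_field_derivative g (Suc m) \<sigma>) (at \<sigma>)" if "\<sigma> \<in> S" for m \<sigma>
  proof -
    have "(g m has_derivative (\<lambda>h. K (h *s line_deriv_f (Suc m) y (q + \<sigma> *s y)) (f q))) (at \<sigma>)"
      unfolding g_def
      by (rule bounded_linear.has_derivative[OF bounded_linear_hform_left line_deriv_f_deriv])
         (use that in \<open>simp add: S_def\<close>)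
    then show ?thesis unfolding has_field_derivative_def by (simp add: hform_simps g_def mult_commute_abs)
  qed
  have hd: "\<sigma> \<in> S \<Longrightarrow> (deriv ^^ m) (g 0) \<sigma> = g m \<sigma>" for m \<sigma>
  proof (induction m arbitrary: \<sigma>)
    case (Suc m)
    have "deriv ((deriv ^^ m) (g 0)) \<sigma> = deriv (g m) \<sigma>"
      by (rule deriv_cong_ev)
         (use Suc S(1) in \<open>auto simp: eventually_nhds intro!: exI[of _ S]\<close>)
    also have "\<dots> = g (Suc m) \<sigma>" by (rule DERIV_imp_deriv[OF g[OF Suc.prems]])
    finally show ?case by simp
  qed simp
  have z: "g m 0 = 0" for m
    using degenerate_all_orders[OF deg q q(1,2) y, of m] hform_eq_0_commute[of sg'] by (simp add: g_def)
  have "g 0 holomorphic_on S"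
    using g S(1) holomorphic_on_open by blast
  then have "g 0 1 = g 0 0"
    by (rule holomorphic_fun_eq_const_on_connected[OF _ S(1,2) _ S(3,4)]) (use hd[OF S(3)] z in simp)
  then show ?thesis
    using z[of 0] hform_eq_0_commute[of sg' "f q" "f x"] by (simp add: g_def y_def line_deriv_f_0)
qed

text \<open>\<open>degenerate_null\<close> treats null points \<open>z\<close> outside the radical,
  and radical points are orthogonal to everything; the null vectors form a set of
  uniqueness.\<close>

lemma null_if_degenerate:
  assumes deg: "\<And>p v. p \<in> B \<Longrightarrow> H p p = 0 \<Longrightarrow> p \<notin> radical sg \<Longrightarrow> K (f p) (Df p v) = 0"
    and p: "p \<in> B" "H p p = 0" "p \<notin> radical sg" and z: "z \<in> B" and x: "x \<in> B"
  shows "K (f z) (f x) = 0"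
proof -
  obtain t where t: "t > 0" "H p (sign_flip sg p) = of_real t"
    using hform_sign_flip_pos[OF sg p(3)] by blast
  then have nz: "H (sign_flip sg p) p \<noteq> 0" using hform_eq_0_commute[of sg p "sign_flip sg p"] by simp
  have holo: "holo_scalar B (\<lambda>z. K (f z) (f x))" by (rule holo_scalar_hform[OF cholo_f])
  show ?thesis
  proof (rule zero_on_null_points[OF holo open_B convex_B, where V = UNIV and q = p and sg = sg
        and v = "sign_flip sg p"])
    fix w assume w: "w \<in> B" "H w w = 0"
    show "K (f w) (f x) = 0"
    proof (cases "w \<in> radical sg")
      case True then show ?thesis using orth[OF w(1) x] hform_radical_left by blast
    next
      case False then show ?thesis using degenerate_null[OF deg w False x] by blast
    qed
  qed (use p z nz in \<open>auto simp: csubspace_def\<close>)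
qed

end

section \<open>The nondegenerate case\<close>

lemma eventually_small_pos:
  assumes "\<forall>\<^sub>F t in nhds (0::real). P t" "\<delta> > 0"
  obtains t where "t > 0" "t < \<delta>" "P t"
proof -
  obtain e where e: "e > 0" "\<And>t. dist t 0 < e \<Longrightarrow> P t"
    using assms(1) unfolding eventually_nhds_metric by blast
  show ?thesis by (rule that[of "min e \<delta> / 2"]) (use e assms(2) in auto)
qed

text \<open>Provides the data for \<open>zero_on_null_points\<close> inside the hyperplane
  orthogonal to \<open>q\<close>. The null cone of that hyperplane is singular at \<open>q\<close>,
  so a nearby point has to be taken.\<close>

lemma (in local_orth) null_point_in_perp:
  assumes "open S" "q \<in> S" "H q q = 0" "q \<notin> radical sg"
  obtains x v where "x \<in> S" "H x x = 0" "H x q = 0" "H v q = 0" "H v x \<noteq> 0"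
proof -
  obtain y a b where wf: "witt_frame sg q y a b"
    using witt_frame_exists[OF sg r2 s2 assms(3,4)] by blast
  interpret witt_frame sg q y a b by fact
  have "\<forall>\<^sub>F t in nhds (0::real). q + t *\<^sub>R (a + b) \<in> S"
    by (rule curve_in_B[OF line_deriv _ assms(1)]) (use assms in simp)
  then obtain t :: real where t: "q + t *\<^sub>R (a + b) \<in> S" "t > 0"
    using eventually_small_pos zero_less_one by blast
  show ?thesis
  proof (rule that[OF t(1), of "a - b"])
    show "H (a - b) (q + t *\<^sub>R (a + b)) \<noteq> 0" using t by (simp add: hform_simps frame)
  qed (simp_all add: hform_simps frame)
qed

locale nondegenerate_at = local_orth sg sg' B f Df + witt_frame sg p y a b
  for sg :: "'n::finite \<Rightarrow> int" and sg' :: "'m::finite \<Rightarrow> int" and B f Df p y a b +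
  assumes p_in: "p \<in> B" and nondegenerate: "scale_at p y \<noteq> 0"
begin

definition c :: real where "c = Re (scale_at p y)"

text \<open>On the unit vector \<open>a\<close>, orthogonal to \<open>p\<close>, the factor appears
  as the square of \<open>Df p a\<close>, which is real.\<close>

lemma scale_at_c: "scale_at p y = of_real c"
proof -
  have "K (Df p a) (Df p a) = scale_at p y"
    using deriv_vs_deriv[OF p_in h_pp h_py h_ap, of a] by (simp add: frame)
  then show ?thesis unfolding c_def using hform_self_real by metis
qed

lemma c_nz: "c \<noteq> 0" using nondegenerate scale_at_c by auto

text \<open>The correction by multiples of \<open>f p\<close> makes the differential at \<open>p\<close> conformal.\<close>

definition T :: "complex^'n \<Rightarrow> complex^'m" where
  "T u = Df p u + (- defect p y (u - H u p *s y) / c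
      - Re (K (Df p y) (Df p y)) / (2 * c) * H u p) *s f p"

lemma defect_linear: "defect p y (u + v) = defect p y u + defect p y v"
   "defect p y (k *s u) = k * defect p y u"
  using p_in by (simp_all add: defect_def Df_simps hform_simps algebra_simps)

lemma clin_T: "clin T"
  unfolding clin_def
proof (intro conjI allI)
  define \<kappa> where "\<kappa> = complex_of_real (Re (K (Df p y) (Df p y)) / (2 * c))"
  define l where "l u = - defect p y (u - H u p *s y) / c - \<kappa> * H u p" for u
  have T: "T u = Df p u + l u *s f p" for u by (simp add: T_def l_def \<kappa>_def)
  fix u v k
  have "u + v - H (u + v) p *s y = (u - H u p *s y) + (v - H v p *s y)"
    by (simp add: hform_simps vec.scale_left_distrib)
  then have "l (u + v) = l u + l v"
    unfolding l_def by (simp only: defect_linear hform_add_left) (simp add: field_simps c_nz)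
  then show "T (u + v) = T u + T v"
    using p_in by (simp add: T Df_simps vec.scale_left_distrib)
  have "k *s u - H (k *s u) p *s y = k *s (u - H u p *s y)"
    by (simp add: hform_simps vec.scale_right_diff_distrib)
  then have "l (k *s u) = k * l u"
    unfolding l_def by (simp only: defect_linear hform_scale_left) (simp add: field_simps c_nz)
  then show "T (k *s u) = k *s T u"
    using p_in by (simp add: T Df_simps vec.scale_right_distrib)
qed

lemma T_simps: "T (u + v) = T u + T v" "T (k *s u) = k *s T u" "T (t *\<^sub>R u) = t *\<^sub>R T u"
  "T (u - v) = T u - T v" "T 0 = 0"
  using clin_T bounded_linear_clin[OF clin_T] by (auto simp: clin_def linear_simps)

text \<open>Split both vectors into a part orthogonal to \<open>p\<close> and a multiple of
  \<open>y\<close>. On the first part, adding multiples of \<open>f p\<close> affects only products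
  with \<open>T y\<close>, where it cancels the defect; the multiple added for \<open>y\<close>
  makes \<open>T y\<close> null.\<close>

lemma T_conformal: "K (T u) (T v) = c * H u v"
proof -
  have perp: "T x = Df p x - (defect p y x / c) *s f p" if "H x p = 0" for x
    using that by (simp add: T_def vec.scale_minus_left)
  have Ty: "T y = Df p y - of_real (Re (K (Df p y) (Df p y)) / (2 * c)) *s f p"
    using defect_linear(2)[of 0 0] by (simp add: T_def frame vec.scale_minus_left)
  have fD: "K (f p) (Df p x) = c * H p x" for x
    using point_vs_deriv[OF p_in h_pp h_py] scale_at_c by simp
  have Df: "K (Df p x) (f p) = c * H x p" for x
    using arg_cong[OF fD[of x], of cnj] by (simp add: cnj_hform)
  have ff: "K (f p) (f p) = 0" by (rule point_point[OF p_in h_pp])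
  have DD: "K (Df p x) (Df p x') = defect p y x * H p x' + c * H x x'" if "H x p = 0" for x x'
    using deriv_vs_deriv[OF p_in h_pp h_py that] scale_at_c by simp
  have 1: "K (T x) (T v) = c * H x v" if x: "H x p = 0" and v: "v = x' + k *s y" "H x' p = 0" for x x' v k
  proof -
    have x'p: "H p x' = 0" "H p x = 0" using v x hform_eq_0_commute by blast+
    have "K (T x) (T x') = c * H x x'"
      using c_nz x v x'p by (simp add: perp hform_simps fD Df ff DD)
    moreover have "K (T x) (T y) = c * H x y"
      using c_nz x x'p by (simp add: perp Ty hform_simps fD Df ff DD frame)
    ultimately show ?thesis by (simp add: v T_simps hform_simps algebra_simps)
  qed
  have yy: "K (T y) (T y) = 0"
  proof -
    have "K (Df p y) (Df p y) = of_real (Re (K (Df p y) (Df p y)))" by (rule hform_self_real)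
    then show ?thesis using c_nz by (simp add: Ty hform_simps fD Df ff frame cnj_hform)
  qed
  define u' where "u' = u - H u p *s y"
  define v' where "v' = v - H v p *s y"
  have u: "u = u' + H u p *s y" "H u' p = 0" by (simp_all add: u'_def hform_simps frame)
  have v: "v = v' + H v p *s y" "H v' p = 0" by (simp_all add: v'_def hform_simps frame)
  have v0: "v' = v' + 0 *s y" by simp
  have y0: "y = 0 + 1 *s y" by simp
  have "K (T y) (T v') = cnj (K (T v') (T y))" by (simp add: cnj_hform)
  also have "\<dots> = c * H y v'" using 1[OF v(2) y0] by (simp add: cnj_hform)
  finally have yv: "K (T y) (T v') = c * H y v'" .
  have Tu: "T u = T u' + H u p *s T y" and Tv: "T v = T v' + H v p *s T y"
    using arg_cong[OF u(1), of T] arg_cong[OF v(1), of T] by (simp_all only: T_simps)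
  have "K (T u) (T v) = K (T u') (T v) + H u p * K (T y) (T v)"
    by (simp only: Tu hform_add_left hform_scale_left)
  also have "K (T y) (T v) = K (T y) (T v') + cnj (H v p) * K (T y) (T y)"
    by (simp only: Tv hform_add_right hform_scale_right)
  also have "\<dots> = c * H y v"
    using arg_cong[OF v(1), of "H y"] by (simp only: hform_add_right hform_scale_right yy yv h_yy) simp
  also have "K (T u') (T v) + H u p * (c * H y v) = c * (H u' v + H u p * H y v)"
    using 1[OF u(2) v] by (simp add: distrib_left)
  also have "H u' v + H u p * H y v = H u v"
    using arg_cong[OF u(1), of "\<lambda>u. H u v"] by (simp only: hform_add_left hform_scale_left)
  finally show ?thesis .
qed

text \<open>The image of \<open>T\<close> contains a negative definite subspace of the maximal possible dimension, so the form
  is positive semidefinite on its orthogonal complement.\<close>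

lemma semidefinite_complement:
  assumes g: "\<And>v. K g (T v) = 0" and gg: "Re (K g g) \<le> 0"
  shows "g \<in> radical sg'"
proof -
  \<comment> \<open>Nonzero vectors supported on the coordinates of sign \<open>\<sigma>\<close> go
    to negative vectors under \<open>T\<close>.\<close>
  define \<sigma> :: int where "\<sigma> = (if c > 0 then -1 else 1)"
  define X where "X x = (\<chi> i. x $ Some i)" for x :: "complex^('n option)"
  have X: "X (x + x') = X x + X x'" "X (k *s x) = k *s X x" for x x' k
    by (auto simp: X_def vec_eq_iff)
  \<comment> \<open>Unknowns are a vector \<open>v\<close> on these coordinates and a multiple
    \<open>l\<close> of \<open>g\<close>; the negative coordinates of \<open>T v + l *s g\<close>
    have to vanish. That is at most \<open>sig_s sg'\<close> equations for at least one more
    unknown.\<close>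
  define K1 where "K1 = (\<lambda>i x. X x $ i) ` {i. sg i \<noteq> \<sigma>}"
  define K2 where "K2 = (\<lambda>j x. T (X x) $ j + x $ None * g $ j) ` {j. sg' j = -1}"
  have fin: "finite (K1 \<union> K2)" by (simp add: K1_def K2_def)
  have "card K1 \<le> card {i. sg i \<noteq> \<sigma>}" unfolding K1_def by (rule card_image_le) simp
  moreover have "card K2 \<le> sig_s sg'" unfolding K2_def sig_s_def by (rule card_image_le) simp
  moreover have "card {i. sg i = \<sigma>} \<ge> sig_s sg'"
    using s_le by (auto simp: \<sigma>_def sig_r_def sig_s_def)
  moreover have "card {i. sg i \<noteq> \<sigma>} + card {i. sg i = \<sigma>} = CARD('n)"
    by (subst card_Un_disjoint[symmetric]) (auto intro!: arg_cong[of _ _ card])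
  moreover have "card (K1 \<union> K2) \<le> card K1 + card K2" by (rule card_Un_le)
  ultimately have "card (K1 \<union> K2) < CARD('n option)" by (simp add: card_UNIV_option)
  then obtain x where x: "x \<noteq> 0" "\<And>\<phi>. \<phi> \<in> K1 \<union> K2 \<Longrightarrow> \<phi> x = 0"
  proof (rule underdetermined_system[OF fin])
    fix \<phi> x x' assume "\<phi> \<in> K1 \<union> K2"
    then show "\<phi> (x + x') = \<phi> x + \<phi> x'"
      by (auto simp: K1_def K2_def X T_simps algebra_simps)
  next
    fix \<phi> k x assume "\<phi> \<in> K1 \<union> K2"
    then show "\<phi> (k *s x) = k * \<phi> x"
      by (auto simp: K1_def K2_def X T_simps algebra_simps)
  qed (use that in blast)
  define v where "v = X x"
  define l where "l = x $ None"
  have v: "v $ i = 0" if "sg i \<noteq> \<sigma>" for i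
    using x(2)[of "\<lambda>x. X x $ i"] that by (auto simp: K1_def v_def)
  have neg: "(T v + l *s g) $ j = 0" if "sg' j = -1" for j
    using x(2)[of "\<lambda>x. T (X x) $ j + x $ None * g $ j"] that by (auto simp: K2_def v_def l_def)
  have g': "K (T u) g = 0" for u using g hform_eq_0_commute by blast
  define N where "N = (\<Sum>i\<in>UNIV. (norm (v$i))\<^sup>2)"
  have "hform sg v v = of_real (of_int \<sigma> * N)"
    unfolding hform_self_sum N_def sum_distrib_left
    by (intro arg_cong[of _ _ of_real] sum.cong refl) (use v in force)
  then have "K (T v) (T v) = of_real (- \<bar>c\<bar> * N)"
    by (auto simp: T_conformal \<sigma>_def)
  moreover have "cnj l * l = of_real ((norm l)\<^sup>2)"
    by (simp add: complex_norm_square mult.commute del: of_real_power)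
  \<comment> \<open>Both summands are nonpositive, yet the total vanishes once the vector is in the
    radical. So \<open>v = 0\<close>, and \<open>l \<noteq> 0\<close> puts \<open>g\<close> into the
    radical.\<close>
  ultimately have E: "K (T v + l *s g) (T v + l *s g) = of_real (- \<bar>c\<bar> * N) + of_real ((norm l)\<^sup>2) * K g g"
    using g g' by (simp add: hform_simps mult.assoc[symmetric] del: of_real_power)
  have N: "N \<ge> 0" by (simp add: N_def sum_nonneg)
  have "(norm l)\<^sup>2 * Re (K g g) \<le> 0" using gg by (simp add: mult_nonneg_nonpos)
  then have le: "Re (K (T v + l *s g) (T v + l *s g)) \<le> 0"
    unfolding E using mult_nonneg_nonneg[OF abs_ge_zero[of c] N] by (simp del: of_real_power)
  have rad: "T v + l *s g \<in> radical sg'"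
    by (rule in_radical_if_no_negative_part[OF sg' neg le])
  then have "Re (K (T v + l *s g) (T v + l *s g)) = 0" by (simp add: hform_radical_left)
  then have "- \<bar>c\<bar> * N + (norm l)\<^sup>2 * Re (K g g) = 0"
    unfolding E by (simp del: of_real_power)
  moreover have "\<bar>c\<bar> * N \<ge> 0" using N by simp
  ultimately have "\<bar>c\<bar> * N = 0" using \<open>(norm l)\<^sup>2 * Re (K g g) \<le> 0\<close> by linarith
  then have "N = 0" using c_nz by simp
  then have "v = 0" unfolding N_def by (subst (asm) sum_nonneg_eq_0_iff) (auto simp: vec_eq_iff)
  have "l \<noteq> 0"
  proof
    assume "l = 0"
    then have "x $ k = 0" for k
      using \<open>v = 0\<close> by (cases k) (auto simp: v_def l_def X_def vec_eq_iff)
    then show False using x(1) by (simp add: vec_eq_iff)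
  qed
  then show ?thesis using rad \<open>v = 0\<close> by (simp add: T_simps radical_scale_iff)
qed

section \<open>Comparison of \<open>f\<close> with \<open>T\<close>, first on the hyperplane
  orthogonal to \<open>p\<close>\<close>

definition lam where "lam z = K (f z) (Df p y)"

text \<open>The difference is orthogonal to the image of \<open>T\<close>. At null \<open>z\<close>
  it is null as well, so \<open>semidefinite_complement\<close> puts it into the radical, and the
  null points of the hyperplane are a set of uniqueness for its coordinates.\<close>

lemma linear_on_perp:
  assumes z: "z \<in> B" "H z p = 0"
  shows "(c * H z y) *s f z - lam z *s T z \<in> radical sg'"
proof -
  let ?X = "\<lambda>z. (c * H z y) *s f z - lam z *s T z"
  have fT: "K (f z) (T v) = K (f z) (Df p v)" if "z \<in> B" "H z p = 0" for z v
    using orth[OF that(1) p_in that(2)] by (simp add: T_def hform_simps)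
  have perp: "K (?X z) (T v) = 0" if "z \<in> B" "H z p = 0" for z v
    using orth_deriv_proportional[OF that(1) p_in that(2), of v y]
    by (simp add: hform_simps fT[OF that] T_conformal lam_def algebra_simps)
  have null: "?X z \<in> radical sg'" if z: "z \<in> B" "H z p = 0" "H z z = 0" for z
  proof (rule semidefinite_complement[OF perp[OF z(1,2)]])
    have "K (f z) (T z) = 0" using fT[OF z(1,2)] orth_deriv[OF z(1) p_in z(2,3)] by simp
    then have "K (T z) (f z) = 0" using hform_eq_0_commute by blast
    moreover have "K (f z) (f z) = 0" using orth z by blast
    ultimately have "K (?X z) (f z) = 0" by (simp add: hform_simps)
    then have "K (?X z) (?X z) = 0"
      using perp[OF z(1,2), of z] by (subst hform_diff_right) (simp add: hform_scale_right)
    then show "Re (K (?X z) (?X z)) \<le> 0" by simp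
  qed
  obtain x v where xv: "x \<in> B" "H x x = 0" "H x p = 0" "H v p = 0" "H v x \<noteq> 0"
    using null_point_in_perp[OF open_B p_in h_pp not_radical] by blast
  have holo: "holo_scalar B (\<lambda>z. ?X z $ j)" for j
  proof -
    have "holo_scalar B (\<lambda>z. c * hform sg z y * f z $ j - lam z * T z $ j)"
      unfolding lam_def
      by (intro holo_scalar_diff holo_scalar_mult holo_scalar_const holo_scalar_hform holo_scalar_nth
            cholo_f cholo_on_id cholo_on_clin clin_T)
    then show ?thesis by simp
  qed
  have "?X z $ j = 0" if j: "sg' j \<noteq> 0" for j
  proof (rule zero_on_null_points[OF holo open_B convex_B, where V = "{z. H z p = 0}" and q = x and sg = sg and v = v])
    show "csubspace {z. H z p = 0}" by (auto simp: csubspace_def hform_simps)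
    fix z assume "z \<in> {z. H z p = 0}" "z \<in> B" "H z z = 0"
    then have "?X z \<in> radical sg'" using null by blast
    then show "?X z $ j = 0" using j unfolding radical_def by blast
  qed (use xv z in auto)
  then show ?thesis unfolding radical_def by blast
qed

lemma p_in_lam: "lam p = c"
  using scale_at_c by (simp add: lam_def scale_at_def)

definition S where "S = {z \<in> B. lam z \<noteq> 0}"

lemma open_S: "open S" and p_in_S: "p \<in> S"
proof -
  have "continuous_on B lam" unfolding lam_def
    by (intro holo_scalar_continuous_on holo_scalar_hform cholo_f)
  then have "open (B \<inter> lam -` (- {0}))" by (intro continuous_open_preimage open_B) auto
  then show "open S" by (simp add: S_def Int_def vimage_def)
  show "p \<in> S" using p_in p_in_lam c_nz by (simp add: S_def)
qed

text \<open>Where \<open>lam x \<noteq> 0\<close>, \<open>T x\<close> is a multiple of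
  \<open>f x\<close> modulo the radical and inherits its orthogonality.\<close>

lemma T_orth:
  assumes z: "z \<in> B" and x: "x \<in> S" "H x p = 0" "H z x = 0"
  shows "K (f z) (T x) = 0"
proof -
  have xB: "x \<in> B" and l: "lam x \<noteq> 0" using x by (auto simp: S_def)
  have "K (f z) ((c * H x y) *s f x - lam x *s T x) = 0"
    by (rule hform_radical_right[OF linear_on_perp[OF xB x(2)]])
  then show ?thesis using orth[OF z xB x(3)] l by (simp add: hform_simps)
qed

definition d where "d = a - b"

lemma d_frame: "H d p = 0" "H p d = 0" "H d y = 0" "H y d = 0" "H d d = 0"
  "H d (a + b) = 2" "H (a + b) d = 2"
  by (simp_all add: d_def hform_simps frame)

text \<open>Coefficients of \<open>K (f z) (T w)\<close> with respect to \<open>H z w\<close> and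
  \<open>H p w\<close>, read off at \<open>w = d\<close>, where \<open>H p d = 0\<close>, and at
  \<open>w = y\<close>, where \<open>H p y = 1\<close>.\<close>

definition al where "al z = K (f z) (T d) / H z d"
definition be where "be z = K (f z) (T y) - al z * H z y"

text \<open>The functional kills the common complement of \<open>z\<close> and \<open>p\<close>, so
  it is a combination of \<open>H z\<close> and \<open>H p\<close>. \<open>T_orth\<close> works only
  on \<open>S\<close>; moving the base point in \<open>S\<close> by a small multiple of
  \<open>u\<close> and subtracting covers all \<open>u\<close>.\<close>

lemma functional_expansion:
  assumes z: "z \<in> B" "H z d \<noteq> 0"
    and x: "p - (H p z / H d z) *s d \<in> S"
  shows "K (f z) (T w) = al z * H z w + be z * H p w"
proof -
  have dz: "H d z \<noteq> 0" using z hform_eq_0_commute by blast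
  define x where "x = p - (H p z / H d z) *s d"
  have xz: "H x z = 0" "H x p = 0" using dz by (auto simp: x_def hform_simps frame d_frame)
  have main: "K (f z) (T u) = 0" if u: "H u z = 0" "H u p = 0" for u
  proof -
    have "\<forall>\<^sub>F t in nhds (0::real). x + t *\<^sub>R u \<in> S"
      by (rule curve_in_B[OF line_deriv _ open_S]) (use assms(3) in \<open>simp add: x_def\<close>)
    then obtain t :: real where t: "x + t *\<^sub>R u \<in> S" "t > 0"
      using eventually_small_pos zero_less_one by blast
    have "H z u = 0" and zx: "H z x = 0" using xz u hform_eq_0_commute by blast+
    then have "H z (x + t *\<^sub>R u) = 0" by (simp add: hform_simps)
    then have "K (f z) (T (x + t *\<^sub>R u)) = 0" "K (f z) (T x) = 0"
      using T_orth[OF z(1) t(1)] T_orth[OF z(1) assms(3)[folded x_def] xz(2) zx] xz u by (auto simp: hform_simps)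
    then show ?thesis using t(2) by (simp add: T_simps hform_simps)
  qed
  define \<beta> where "\<beta> = H w p"
  define \<alpha> where "\<alpha> = (H w z - \<beta> * H y z) / H d z"
  have "K (f z) (T (w - \<alpha> *s d - \<beta> *s y)) = 0"
    by (rule main) (use dz in \<open>auto simp: \<alpha>_def \<beta>_def hform_simps frame d_frame\<close>)
  then have "K (f z) (T w) = cnj \<alpha> * K (f z) (T d) + cnj \<beta> * K (f z) (T y)"
    by (simp add: T_simps hform_simps algebra_simps)
  moreover have "cnj \<alpha> = (H z w - H p w * H z y) / H z d" "cnj \<beta> = H p w"
    by (simp_all add: \<alpha>_def \<beta>_def cnj_hform)
  ultimately show ?thesis using z(2) by (simp add: be_def al_def field_simps)
qed

text \<open>As \<open>d\<close> is orthogonal to \<open>p\<close>, the centre is moved to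
  \<open>z0 = p + \<epsilon> *\<^sub>R (a + b)\<close>, where \<open>H z0 d = 2 * \<epsilon>\<close>
  and, by \<open>linear_on_perp\<close>, \<open>K (f z0) (T d) \<noteq> 0\<close>. All conditions
  are open.\<close>

lemma good_neighbourhood:
  obtains O' \<epsilon> where "open O'" "convex O'" "O' \<subseteq> B" "\<epsilon> > 0" "p + \<epsilon> *\<^sub>R (a + b) \<in> O'"
    "\<And>z. z \<in> O' \<Longrightarrow> H z d \<noteq> 0" "\<And>z. z \<in> O' \<Longrightarrow> al z \<noteq> 0"
    "\<And>z w. z \<in> O' \<Longrightarrow> K (f z) (T w) = al z * H z w + be z * H p w"
proof -
  have "\<forall>\<^sub>F t in nhds (0::real). p + t *\<^sub>R (a + b) \<in> S"
    by (rule curve_in_B[OF line_deriv _ open_S]) (simp add: p_in_S)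
  then obtain \<epsilon> :: real where \<epsilon>: "p + \<epsilon> *\<^sub>R (a + b) \<in> S" "\<epsilon> > 0"
    using eventually_small_pos zero_less_one by blast
  define z0 where "z0 = p + \<epsilon> *\<^sub>R (a + b)"
  have z0: "z0 \<in> B" "lam z0 \<noteq> 0" using \<epsilon> by (auto simp: S_def z0_def)
  have z0p: "H z0 p = 0" "H p z0 = 0" "H z0 y = 1" "H z0 d = 2 * \<epsilon>" "H d z0 = 2 * \<epsilon>"
    by (simp_all add: z0_def hform_simps frame d_frame d_frame(6,7)[unfolded hform_simps])
  have "K ((c * H z0 y) *s f z0 - lam z0 *s T z0) (T d) = 0"
    by (rule hform_radical_left[OF linear_on_perp[OF z0(1) z0p(1)]])
  then have "c * K (f z0) (T d) = lam z0 * (c * (2 * \<epsilon>))"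
    by (simp add: hform_simps[of sg'] z0p T_conformal)
  then have nz: "K (f z0) (T d) \<noteq> 0" using \<epsilon> z0 c_nz by auto
  have 1: "\<forall>\<^sub>F z in nhds z0. z \<in> B" using open_B z0(1) by (simp add: eventually_nhds_in_open)
  have H1: "((\<lambda>z. H z w) \<longlongrightarrow> H z0 w) (nhds z0)" "((\<lambda>z. H w z) \<longlongrightarrow> H w z0) (nhds z0)" for w
    by (intro tendsto_intros tendsto_ident_at filterlim_ident)+
  have 2: "\<forall>\<^sub>F z in nhds z0. H z d \<noteq> 0"
    using tendsto_imp_eventually_ne[OF H1(1)[of d], of 0] \<epsilon> z0p by simp
  have "continuous (at z0) f" using deriv_f[OF z0(1)] has_derivative_continuous by blast
  then have "(f \<longlongrightarrow> f z0) (nhds z0)"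
    unfolding continuous_at tendsto_at_iff_tendsto_nhds .
  then have "((\<lambda>z. K (f z) (T d)) \<longlongrightarrow> K (f z0) (T d)) (nhds z0)" by (intro tendsto_intros)
  then have 3: "\<forall>\<^sub>F z in nhds z0. K (f z) (T d) \<noteq> 0"
    using tendsto_imp_eventually_ne nz by blast
  \<comment> \<open>At \<open>z0\<close> the base point of \<open>functional_expansion\<close> is
    \<open>p\<close> itself, because \<open>H p z0 = 0\<close>.\<close>
  have "((\<lambda>z. p - (H p z / H d z) *s d) \<longlongrightarrow> p - (H p z0 / H d z0) *s d) (nhds z0)"
    using \<epsilon> z0p
    by (intro tendsto_intros bounded_linear.tendsto[OF bounded_linear_scale_left] H1) auto
  then have "((\<lambda>z. p - (H p z / H d z) *s d) \<longlongrightarrow> p) (nhds z0)" using z0p by simp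
  then have 4: "\<forall>\<^sub>F z in nhds z0. p - (H p z / H d z) *s d \<in> S"
    using open_S p_in_S by (rule topological_tendstoD)
  from 1 2 3 4 have "\<forall>\<^sub>F z in nhds z0. z \<in> B \<and> H z d \<noteq> 0 \<and> K (f z) (T d) \<noteq> 0 \<and>
      p - (H p z / H d z) *s d \<in> S"
    by eventually_elim auto
  then obtain e where e: "e > 0" "\<And>z. dist z z0 < e \<Longrightarrow> z \<in> B \<and> H z d \<noteq> 0 \<and> K (f z) (T d) \<noteq> 0 \<and>
      p - (H p z / H d z) *s d \<in> S"
    unfolding eventually_nhds_metric by blast
  show ?thesis
  proof (rule that[of "ball z0 e" \<epsilon>])
    show "\<epsilon> > 0" by fact
    show "p + \<epsilon> *\<^sub>R (a + b) \<in> ball z0 e" using e(1) by (simp add: z0_def)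
    show "K (f z) (T w) = al z * H z w + be z * H p w" if "z \<in> ball z0 e" for z w
      by (rule functional_expansion) (use e(2)[of z] that in \<open>auto simp: dist_commute\<close>)
  qed (use e(2) in \<open>auto simp: dist_commute al_def\<close>)
qed

end

section \<open>The deviation of \<open>f\<close> from a linear map\<close>

locale good_nbhd = nondegenerate_at sg sg' B f Df p y a b
  for sg :: "'n::finite \<Rightarrow> int" and sg' :: "'m::finite \<Rightarrow> int" and B f Df p y a b +
  fixes O' :: "(complex^'n) set" and \<epsilon> :: real
  assumes open_O: "open O'" and convex_O: "convex O'" and O_sub: "O' \<subseteq> B"
    and eps: "\<epsilon> > 0" and z0_in: "p + \<epsilon> *\<^sub>R (a + b) \<in> O'"
    and d_nz: "z \<in> O' \<Longrightarrow> H z d \<noteq> 0" and al_nz: "z \<in> O' \<Longrightarrow> al z \<noteq> 0"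
    and expansion: "z \<in> O' \<Longrightarrow> K (f z) (T w) = al z * H z w + be z * H p w"
begin

text \<open>After division by \<open>al z\<close>, \<open>nh z\<close> is the part of
  \<open>f z\<close> orthogonal to the image of \<open>T\<close>, and
  \<open>T (z + bh z *s p) / c\<close> is the rest.\<close>

definition bh where "bh z = be z / al z"
definition nh where "nh z = (1 / al z) *s f z - (1 / c) *s T (z + bh z *s p)"

lemma f_nh: "z \<in> O' \<Longrightarrow> f z = al z *s (nh z + (1 / c) *s T (z + bh z *s p))"
  using al_nz by (simp add: nh_def)

lemma nh_perp: "z \<in> O' \<Longrightarrow> K (nh z) (T w) = 0"
  using al_nz[of z] c_nz
  by (simp add: nh_def hform_simps T_conformal expansion bh_def field_simps)

text \<open>Expand \<open>K (f z) (f w) = 0\<close> with \<open>f_nh\<close>: the mixed terms vanish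
  by \<open>nh_perp\<close>, and \<open>H p p = 0\<close> leaves a hyperbolic form in
  \<open>H z p\<close> and \<open>bh z\<close>.\<close>

lemma nh_pair:
  assumes z: "z \<in> O'" and w: "w \<in> O'" and zw: "H z w = 0"
  shows "K (nh z) (nh w) = - (cnj (bh w) * H z p + bh z * H p w) / c"
proof -
  have Tn: "K (T u) (nh w) = 0" for u using nh_perp[OF w] hform_eq_0_commute by blast
  have "0 = K (f z) (f w)" using orth[of z w] z w zw O_sub by auto
  also have "\<dots> = al z * cnj (al w) * (K (nh z) (nh w) + (1 / c) * (cnj (bh w) * H z p + bh z * H p w))"
    using c_nz by (simp add: f_nh[OF z] f_nh[OF w] hform_scale_left hform_scale_right hform_add_left[of sg']
        hform_add_right[of sg'] nh_perp[OF z] Tn T_conformal)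
      (simp add: hform_simps zw frame field_simps)
  finally have "K (nh z) (nh w) + (1 / c) * (cnj (bh w) * H z p + bh z * H p w) = 0"
    using al_nz z w by simp
  then have "K (nh z) (nh w) = - ((1 / c) * (cnj (bh w) * H z p + bh z * H p w))"
    by (simp only: eq_neg_iff_add_eq_0)
  then show ?thesis by (simp add: add_divide_distrib diff_divide_distrib)
qed

lemma holo_al: "holo_scalar O' al"
  unfolding al_def
  by (intro holo_scalar_divide holo_scalar_hform cholo_on_id cholo_on_subset[OF cholo_f O_sub])
     (use d_nz in \<open>simp add: d_def\<close>)

lemma holo_bh: "holo_scalar O' bh"
  unfolding bh_def be_def
  by (intro holo_scalar_divide holo_scalar_diff holo_scalar_mult holo_al holo_scalar_hform cholo_on_id
      cholo_on_subset[OF cholo_f O_sub] al_nz)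

lemma holo_nh: "holo_scalar O' (\<lambda>z. nh z $ j)"
proof -
  have "holo_scalar O' (\<lambda>z. 1 / al z * f z $ j - 1 / c * (T z $ j + bh z * T p $ j))"
    by (intro holo_scalar_divide holo_scalar_diff holo_scalar_mult holo_scalar_add holo_al holo_bh
        holo_scalar_nth holo_scalar_const cholo_on_subset[OF cholo_f O_sub] cholo_on_clin clin_T al_nz)
  then show ?thesis by (simp add: nh_def T_simps add_divide_distrib)
qed

text \<open>The map \<open>z \<mapsto> (H z p, bh z, nh z)\<close> preserves orthogonality, with values in a space whose form has just one
  negative square; hence it maps orthogonal null points to proportional vectors.\<close>

lemma proportional_on_perp:
  assumes q: "q \<in> O'" "H q q = 0" "H q p \<noteq> 0" and z: "z \<in> O'" "H z q = 0"
  shows "H q p * bh z = H z p * bh q" and "H q p *s nh z - H z p *s nh q \<in> radical sg'"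
proof -
  have null: "H q p *s nh z - H z p *s nh q \<in> radical sg' \<and> H q p * bh z - H z p * bh q = 0"
    if z: "z \<in> O'" "H z q = 0" and zz: "H z z = 0" for z
  proof -
    \<comment> \<open>This combination of two null, mutually orthogonal triples has first component
      zero, so its square, which is zero, is that of \<open>n\<close>.\<close>
    define n where "n = H q p *s nh z - H z p *s nh q"
    have qz: "H q z = 0" using z hform_eq_0_commute by blast
    have [simp]: "cnj (H q p) = H p q" "cnj (H z p) = H p z" by (simp_all add: cnj_hform)
    note pairs = nh_pair[OF z(1) z(1) zz] nh_pair[OF z(1) q(1) z(2)] nh_pair[OF q(1) z(1) qz] nh_pair[OF q(1) q(1) q(2)]
    have "K n n = 0" using c_nz by (simp add: n_def hform_simps pairs field_simps)
    moreover have "K n (T w) = 0" for w by (simp add: n_def hform_simps nh_perp z q)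
    ultimately have n: "n \<in> radical sg'" by (intro semidefinite_complement) auto
    \<comment> \<open>With \<open>n\<close> in the radical, pairing with \<open>nh q\<close>
      isolates the relation for \<open>bh\<close>.\<close>
    have "0 = K n (nh q)" using hform_radical_left[OF n] by simp
    also have "\<dots> = - H p q / c * (H q p * bh z - H z p * bh q)"
      using c_nz by (simp add: n_def hform_simps pairs field_simps)
    finally have "H q p * bh z - H z p * bh q = 0"
      using c_nz q(3) hform_eq_0_commute[of sg p q] by simp
    then show ?thesis using n by (simp add: n_def)
  qed
  have "q \<notin> radical sg" using q(3) hform_radical_left by blast
  then obtain x v where xv: "x \<in> O'" "H x x = 0" "H x q = 0" "H v q = 0" "H v x \<noteq> 0"
    using null_point_in_perp[OF open_O q(1,2)] by blast
  have V: "csubspace {z. H z q = 0}" by (auto simp: csubspace_def hform_simps)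
  note ext = zero_on_null_points[OF _ open_O convex_O V, where q = x and sg = sg and v = v]
  have "H q p * bh z - H z p * bh q = 0"
    by (rule ext[where h = "\<lambda>z. H q p * bh z - H z p * bh q"])
       (use null xv z in \<open>auto intro!: holo_scalar_diff holo_scalar_mult holo_scalar_const holo_bh holo_scalar_hform cholo_on_id\<close>)
  then show "H q p * bh z = H z p * bh q" by simp
  have "H q p * nh z $ j - H z p * nh q $ j = 0" if j: "sg' j \<noteq> 0" for j
  proof (rule ext[where h = "\<lambda>z. H q p * nh z $ j - H z p * nh q $ j"])
    fix z assume "z \<in> {z. H z q = 0}" "z \<in> O'" "H z z = 0"
    then have "H q p *s nh z - H z p *s nh q \<in> radical sg'" using null by blast
    then show "H q p * nh z $ j - H z p * nh q $ j = 0" using j by (auto simp: radical_def)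
  qed (use xv z in \<open>auto intro!: holo_scalar_diff holo_scalar_mult holo_scalar_const holo_nh holo_scalar_hform cholo_on_id\<close>)
  then show "H q p *s nh z - H z p *s nh q \<in> radical sg'" by (auto simp: radical_def)
qed

lemma transversal_null_point:
  obtains q where "q \<in> O'" "H q q = 0" "H q p \<noteq> 0"
proof -
  \<comment> \<open>\<open>v\<close> is null and orthogonal to the null vector
    \<open>p + \<epsilon> *\<^sub>R (a + b)\<close>, so the whole line is null, while
    \<open>H v p = 1\<close>.\<close>
  define v where "v = y - (1 / (2 * \<epsilon>)) *\<^sub>R d"
  have "\<forall>\<^sub>F t in nhds (0::real). (p + \<epsilon> *\<^sub>R (a + b)) + t *\<^sub>R v \<in> O'"
    by (rule curve_in_B[OF line_deriv _ open_O]) (use z0_in in simp)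
  then obtain t where t: "t > 0" "(p + \<epsilon> *\<^sub>R (a + b)) + t *\<^sub>R v \<in> O'"
    using eventually_small_pos zero_less_one by blast
  show ?thesis
  proof (rule that[OF t(2)])
    show "H ((p + \<epsilon> *\<^sub>R (a + b)) + t *\<^sub>R v) ((p + \<epsilon> *\<^sub>R (a + b)) + t *\<^sub>R v) = 0"
      using eps by (simp add: v_def hform_simps frame d_frame d_frame(6,7)[unfolded hform_simps] d_def)
    show "H ((p + \<epsilon> *\<^sub>R (a + b)) + t *\<^sub>R v) p \<noteq> 0"
      using t(1) by (simp add: v_def hform_simps frame d_frame)
  qed
qed

text \<open>The null point \<open>q\<close> is found by the intermediate value theorem, perturbing \<open>q0\<close> along a direction transversal
  to the null cone inside the orthogonal complement of \<open>z1\<close> and \<open>v\<close>.\<close>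

lemma null_points_orthogonal_to_directions:
  assumes q0: "q0 \<in> O'" "H q0 q0 = 0" "H q0 p \<noteq> 0"
  obtains z1 v0 N where "z1 \<in> O'" "H z1 p \<noteq> 0" "H z1 q0 = 0" "open N" "v0 \<in> N" "z1 + v0 \<in> O'"
    "\<And>v. v \<in> N \<Longrightarrow> \<exists>q\<in>O'. H q q = 0 \<and> H q p \<noteq> 0 \<and> H q z1 = 0 \<and> H q v = 0"
proof -
  have "q0 \<notin> radical sg" using q0(3) hform_radical_left by blast
  then obtain y0 a0 b0 where wf: "witt_frame sg q0 y0 a0 b0"
    using witt_frame_exists[OF sg r2 s2 q0(2)] by blast
  then interpret W: witt_frame sg q0 y0 a0 b0 .
  define S' where "S' = O' \<inter> {q. H q p \<noteq> 0}"
  have S': "open S'" "q0 \<in> S'"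
  proof -
    have "open {q. H q p \<noteq> 0}" by (intro open_Collect_neq continuous_intros)
    then show "open S'" unfolding S'_def using open_O by blast
  qed (use q0 in \<open>auto simp: S'_def\<close>)
  have "\<forall>\<^sub>F t in nhds (0::real). q0 + t *\<^sub>R a0 \<in> S'"
    by (rule curve_in_B[OF line_deriv _ S'(1)]) (use S' in simp)
  then obtain \<eta> where \<eta>: "\<eta> > 0" "q0 + \<eta> *\<^sub>R a0 \<in> S'"
    using eventually_small_pos zero_less_one by blast
  define z1 where "z1 = q0 + \<eta> *\<^sub>R a0"
  have "\<forall>\<^sub>F t in nhds (0::real). z1 + t *\<^sub>R b0 \<in> O'"
    by (rule curve_in_B[OF line_deriv _ open_O]) (use \<eta> in \<open>simp add: z1_def S'_def\<close>)
  then obtain t0 where t0: "t0 > 0" "z1 + t0 *\<^sub>R b0 \<in> O'"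
    using eventually_small_pos zero_less_one by blast
  define v0 where "v0 = t0 *\<^sub>R b0"
  \<comment> \<open>Orthogonal to \<open>z1\<close> and \<open>b0\<close>, with
    \<open>H e q0 = 1\<close>, so that moving along \<open>e\<close> crosses the null cone.\<close>
  define e where "e = y0 - (1 / \<eta>) *\<^sub>R a0"
  \<comment> \<open>The multiple of \<open>b0\<close>, itself orthogonal to \<open>z1\<close>, makes
    the vector orthogonal to \<open>fst x\<close>; it is zero for \<open>v0\<close>.\<close>
  define Q where "Q x = (q0 + snd x *\<^sub>R e) - (H (q0 + snd x *\<^sub>R e) (fst x) / H b0 (fst x)) *s b0"
    for x :: "(complex^'n) \<times> real"
  have b0v0: "H b0 v0 = - of_real t0" by (simp add: v0_def hform_simps W.frame)
  have Q0: "Q (v0, s) = q0 + s *\<^sub>R e" for s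
    by (simp add: Q_def v0_def e_def hform_simps W.frame)
  have Qz1: "H (Q x) z1 = 0" for x
    using \<eta> by (simp add: Q_def z1_def e_def hform_simps W.frame)
  have Qv: "H (Q (v, s)) v = 0" if "H b0 v \<noteq> 0" for v s
    using that by (simp add: Q_def hform_simps)
  have QQ: "Re (H (Q (v0, s)) (Q (v0, s))) = 2 * s + s\<^sup>2 / \<eta>\<^sup>2" for s
    using \<eta> by (simp add: Q0 e_def hform_simps W.frame power2_eq_square algebra_simps)
  define D where "D = {v. H b0 v \<noteq> 0}"
  have D: "open D" "v0 \<in> D"
    unfolding D_def using b0v0 t0 by (auto intro!: open_Collect_neq continuous_intros)
  have Qc: "continuous_on (D \<times> UNIV) Q"
    unfolding Q_def D_def
    by (intro continuous_intros bounded_linear.continuous_on[OF bounded_linear_scale_left]) auto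
  have Do: "open (D \<times> (UNIV :: real set))" by (intro open_Times D open_UNIV)
  have "open ((D \<times> UNIV) \<inter> Q -` S')"
    by (rule continuous_open_preimage[OF Qc Do S'(1)])
  moreover have "(v0, 0) \<in> (D \<times> UNIV) \<inter> Q -` S'" using D S' by (simp add: Q0)
  ultimately obtain N1 J where N1: "open N1" "open J" "(v0, 0) \<in> N1 \<times> J" "N1 \<times> J \<subseteq> (D \<times> UNIV) \<inter> Q -` S'"
    by (rule open_prod_elim)
  obtain \<rho> where \<rho>: "\<rho> > 0" "cball 0 \<rho> \<subseteq> J"
    using N1(2,3) open_contains_cball by (metis mem_Sigma_iff)
  \<comment> \<open>The bound \<open>\<eta>\<^sup>2\<close> keeps the square
    \<open>2 * s + s\<^sup>2 / \<eta>\<^sup>2\<close> negative when \<open>s\<close> is replaced by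
    \<open>- s\<close>; both signs persist for \<open>v\<close> near \<open>v0\<close>.\<close>
  define s where "s = min \<rho> (\<eta>\<^sup>2)"
  have s: "s > 0" "s \<le> \<rho>" "s \<le> \<eta>\<^sup>2" using \<rho> \<eta> by (auto simp: s_def)
  define \<phi> where "\<phi> v t = Re (H (Q (v, t)) (Q (v, t)))" for v t
  have pos: "\<phi> v0 s > 0" using s by (simp add: \<phi>_def QQ add_pos_nonneg)
  have neg: "\<phi> v0 (- s) < 0"
  proof -
    have "s\<^sup>2 / \<eta>\<^sup>2 \<le> s"
      using s \<eta> mult_left_mono[OF s(3), of s] by (simp add: power2_eq_square divide_le_eq)
    then show ?thesis using s by (simp add: \<phi>_def QQ)
  qed
  have \<phi>c: "continuous_on D (\<lambda>v. \<phi> v t)" for t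
    unfolding \<phi>_def
    by (intro continuous_intros continuous_on_compose2[OF Qc, of D "\<lambda>v. (v, t)"]) auto
  define N where "N = N1 \<inter> (D \<inter> (\<lambda>v. \<phi> v s) -` {0<..}) \<inter> (D \<inter> (\<lambda>v. \<phi> v (- s)) -` {..<0})"
  show ?thesis
  proof (rule that[of z1 N v0])
    show "z1 \<in> O'" "H z1 p \<noteq> 0" using \<eta> by (auto simp: z1_def S'_def)
    show "H z1 q0 = 0" by (simp add: z1_def hform_simps W.frame)
    show "open N" unfolding N_def
      by (intro open_Int N1 continuous_open_preimage[OF \<phi>c D(1)]) auto
    show "v0 \<in> N" using N1 D pos neg by (auto simp: N_def)
    show "z1 + v0 \<in> O'" using t0 by (simp add: v0_def)
    fix v assume v: "v \<in> N"
    then have vD: "v \<in> D" by (simp add: N_def)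
    have "\<exists>t\<ge>-s. t \<le> s \<and> \<phi> v t = 0"
    proof (rule IVT')
      show "\<phi> v (- s) \<le> 0" "0 \<le> \<phi> v s" using v by (auto simp: N_def)
      show "- s \<le> s" using s by simp
      show "continuous_on {- s..s} (\<phi> v)"
        unfolding \<phi>_def
        by (intro continuous_intros continuous_on_compose2[OF Qc, of _ "\<lambda>t. (v, t)"]) (use vD in auto)
    qed
    then obtain t where t: "\<bar>t\<bar> \<le> s" "\<phi> v t = 0" by (metis abs_le_iff minus_le_iff)
    have "(v, t) \<in> N1 \<times> J" using v t s \<rho> by (auto simp: N_def)
    then have "Q (v, t) \<in> S'" using N1(4) by blast
    moreover have "H (Q (v, t)) (Q (v, t)) = 0" using t(2) by (subst hform_self_real) (simp add: \<phi>_def)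
    moreover have "H (Q (v, t)) v = 0" using Qv vD by (simp add: D_def)
    ultimately show "\<exists>q\<in>O'. H q q = 0 \<and> H q p \<noteq> 0 \<and> H q z1 = 0 \<and> H q v = 0"
      using Qz1 by (auto simp: S'_def)
  qed
qed

text \<open>A null \<open>q\<close> orthogonal to \<open>z1\<close> and \<open>z\<close> carries the
  ratios of \<open>bh\<close> and \<open>nh\<close> to \<open>H z p\<close> over from
  \<open>z1\<close> to \<open>z\<close>. Near \<open>z1 + v0\<close> they are constants
  \<open>\<beta>\<close> and, modulo the radical, \<open>\<nu>\<close>; so \<open>f_nh\<close>
  becomes linear up to the factor \<open>al\<close>.\<close>

lemma linear_on_open_subset:
  obtains O2 L where "open O2" "O2 \<noteq> {}" "O2 \<subseteq> B" "clin L"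
    "\<And>z w. K (L z) (L w) = (1 / c) * H z w" "\<And>z. z \<in> O2 \<Longrightarrow> f z - al z *s L z \<in> radical sg'"
proof -
  obtain q0 where q0: "q0 \<in> O'" "H q0 q0 = 0" "H q0 p \<noteq> 0" by (rule transversal_null_point)
  obtain z1 v0 N where z1: "z1 \<in> O'" "H z1 p \<noteq> 0" "H z1 q0 = 0" and N: "open N" "v0 \<in> N" "z1 + v0 \<in> O'"
    "\<And>v. v \<in> N \<Longrightarrow> \<exists>q\<in>O'. H q q = 0 \<and> H q p \<noteq> 0 \<and> H q z1 = 0 \<and> H q v = 0"
    using null_points_orthogonal_to_directions[OF q0] by metis
  define \<beta> where "\<beta> = bh z1 / H z1 p"
  define \<nu> where "\<nu> = (1 / H z1 p) *s nh z1"
  have perp: "bh q = H q p * \<beta>" "nh q - H q p *s \<nu> \<in> radical sg'"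
    if q: "q \<in> O'" "H q q = 0" "H q p \<noteq> 0" "H z1 q = 0" for q
  proof -
    note P = proportional_on_perp[OF q(1-3) z1(1) q(4)]
    show "bh q = H q p * \<beta>" using P(1) z1(2) by (simp add: \<beta>_def field_simps)
    have "nh q - H q p *s \<nu> = (- 1 / H z1 p) *s (H q p *s nh z1 - H z1 p *s nh q)"
      using z1(2) by (simp add: \<nu>_def vec_eq_iff field_simps)
    then show "nh q - H q p *s \<nu> \<in> radical sg'" using radical_scale[OF P(2)] by metis
  qed
  define O2 where "O2 = O' \<inter> (\<lambda>z. z - z1) -` N"
  have O2: "bh z = H z p * \<beta>" "nh z - H z p *s \<nu> \<in> radical sg'" if z: "z \<in> O2" for z
  proof -
    have zO: "z \<in> O'" "z - z1 \<in> N" using z by (auto simp: O2_def)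
    obtain q where q: "q \<in> O'" "H q q = 0" "H q p \<noteq> 0" "H q z1 = 0" "H q (z - z1) = 0"
      using N(4)[OF zO(2)] by blast
    have "H z1 q = 0" using q(4) hform_eq_0_commute by blast
    note pq = perp[OF q(1-3) this]
    have "H q z = 0" using q(4,5) by (simp add: hform_diff_right)
    then have "H z q = 0" using hform_eq_0_commute by blast
    note P = proportional_on_perp[OF q(1-3) zO(1) this]
    show "bh z = H z p * \<beta>" using P(1) pq(1) q(3) by simp
    have "nh z - H z p *s \<nu> = (1 / H q p) *s ((H q p *s nh z - H z p *s nh q) + H z p *s (nh q - H q p *s \<nu>))"
      using q(3) by (simp add: vec_eq_iff field_simps)
    then show "nh z - H z p *s \<nu> \<in> radical sg'"
      using radical_scale[OF radical_add[OF P(2) radical_scale[OF pq(2)]]] by metis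
  qed
  define L where "L z = (1 / c) *s T (z + (\<beta> * H z p) *s p) + H z p *s \<nu>" for z
  have \<nu>T: "K \<nu> (T w) = 0" "K (T w) \<nu> = 0" for w
    using nh_perp[OF z1(1)] hform_eq_0_commute[of sg' \<nu>] by (auto simp: \<nu>_def hform_simps)
  \<comment> \<open>At the null vector \<open>q0\<close>, \<open>nh_pair\<close> yields the identity
    that cancels the correction terms in products of values of \<open>L\<close>.\<close>
  have const: "K \<nu> \<nu> + (cnj \<beta> + \<beta>) / c = 0"
  proof -
    note P = perp[OF q0 z1(3)]
    have [simp]: "cnj (H q0 p) = H p q0" by (simp add: cnj_hform)
    have pq0: "H p q0 \<noteq> 0" using q0(3) hform_eq_0_commute by blast
    define \<rho> where "\<rho> = nh q0 - H q0 p *s \<nu>"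
    have "nh q0 = H q0 p *s \<nu> + \<rho>" by (simp add: \<rho>_def)
    then have "K (nh q0) (nh q0) = H q0 p * H p q0 * K \<nu> \<nu>"
      using P(2)[folded \<rho>_def] by (simp add: hform_simps hform_radical_left hform_radical_right)
    moreover have "K (nh q0) (nh q0) = - (H q0 p * H p q0 * ((cnj \<beta> + \<beta>) / c))"
      unfolding nh_pair[OF q0(1) q0(1) q0(2)] using c_nz by (simp add: P(1) field_simps)
    ultimately have "H q0 p * H p q0 * K \<nu> \<nu> = - (H q0 p * H p q0 * ((cnj \<beta> + \<beta>) / c))"
      by (rule trans[OF sym])
    then have "H q0 p * H p q0 * (K \<nu> \<nu> + (cnj \<beta> + \<beta>) / c) = 0"
      by (simp only: distrib_left[of "H q0 p * H p q0" "K \<nu> \<nu>"] left_minus)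
    then show ?thesis using q0(3) pq0 by simp
  qed
  show ?thesis
  proof (rule that[of O2 L])
    show "open O2" unfolding O2_def
      by (intro open_Int open_O open_vimage N continuous_intros)
    have "z1 + v0 \<in> O2" using N by (simp add: O2_def)
    then show "O2 \<noteq> {}" by blast
    show "O2 \<subseteq> B" using O_sub by (auto simp: O2_def)
    define M where "M z = z + (\<beta> * H z p) *s p" for z
    have M: "M (u + v) = M u + M v" "M (k *s u) = k *s M u" for u v k
      by (simp_all add: M_def hform_simps vec.scale_left_distrib vec.scale_right_distrib distrib_left mult.left_commute)
    have L: "L z = (1 / c) *s T (M z) + H z p *s \<nu>" for z by (simp only: L_def M_def)
    have "L (u + v) = L u + L v" for u v
      by (simp only: L M T_simps hform_add_left vec.scale_left_distrib vec.scale_right_distrib add_ac)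
    moreover have "L (k *s u) = k *s L u" for u k
      by (simp only: L M T_simps hform_scale_left vec.scale_scale vec.scale_right_distrib mult.commute[of k])
    ultimately show "clin L" unfolding clin_def by blast
    show "K (L z) (L w) = (1 / c) * H z w" for z w
    proof -
      have "K (L z) (L w) = (1 / c) * H (z + (\<beta> * H z p) *s p) (w + (\<beta> * H w p) *s p) + H z p * cnj (H w p) * K \<nu> \<nu>"
        unfolding L_def using c_nz
        by (simp add: hform_add_left[of sg'] hform_add_right[of sg'] hform_scale_left[of sg']
            hform_scale_right[of sg'] T_conformal \<nu>T)
      also have "\<dots> = (1 / c) * H z w + H z p * H p w * (K \<nu> \<nu> + (cnj \<beta> + \<beta>) / c)"
        using c_nz by (simp add: hform_simps frame cnj_hform field_simps)
      finally show ?thesis using const by simp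
    qed
    show "f z - al z *s L z \<in> radical sg'" if z: "z \<in> O2" for z
    proof -
      have "f z - al z *s L z = al z *s (nh z - H z p *s \<nu>)"
        using z O2(1)[OF z] by (subst f_nh) (auto simp: O2_def L_def vec_eq_iff algebra_simps)
      then show ?thesis using radical_scale[OF O2(2)[OF z]] by metis
    qed
  qed
qed

end

theorem (in local_orth) null_or_locally_linear:
  assumes p: "p \<in> B" "H p p = 0" "p \<notin> radical sg"
  shows "(\<forall>z\<in>B. \<forall>w\<in>B. K (f z) (f w) = 0) \<or>
    (\<exists>O2 L \<mu>. open O2 \<and> O2 \<noteq> {} \<and> O2 \<subseteq> B \<and> clin L \<and> \<mu> \<noteq> 0 \<and>
      (\<forall>z w. K (L z) (L w) = of_real \<mu> * H z w) \<and> (\<forall>z\<in>O2. \<exists>\<alpha>. f z - \<alpha> *s L z \<in> radical sg'))"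
proof (cases "\<forall>p v. p \<in> B \<longrightarrow> H p p = 0 \<longrightarrow> p \<notin> radical sg \<longrightarrow> K (f p) (Df p v) = 0")
  case True
  then have "K (f q) (Df q v) = 0" if "q \<in> B" "H q q = 0" "q \<notin> radical sg" for q v
    using that by simp
  from null_if_degenerate[OF this p] show ?thesis by simp
next
  case False
  then obtain q v where q: "q \<in> B" "H q q = 0" "q \<notin> radical sg" "K (f q) (Df q v) \<noteq> 0" by blast
  obtain y a b where wf: "witt_frame sg q y a b"
    using witt_frame_exists[OF sg r2 s2 q(2,3)] by blast
  have "scale_at q y \<noteq> 0"
    using point_vs_deriv[OF q(1,2) witt_frame.h_py[OF wf], of v] q(4) by auto
  then interpret nondegenerate_at sg sg' B f Df q y a b
    using wf q(1) by (intro nondegenerate_at.intro local_orth_axioms nondegenerate_at_axioms.intro)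
  obtain O' \<epsilon> where O': "open O'" "convex O'" "O' \<subseteq> B" "\<epsilon> > 0" "q + \<epsilon> *\<^sub>R (a + b) \<in> O'"
    "\<And>z. z \<in> O' \<Longrightarrow> H z d \<noteq> 0" "\<And>z. z \<in> O' \<Longrightarrow> al z \<noteq> 0"
    "\<And>z w. z \<in> O' \<Longrightarrow> K (f z) (T w) = al z * H z w + be z * H q w"
    by (rule good_neighbourhood) blast
  interpret good_nbhd sg sg' B f Df q y a b O' \<epsilon>
    by unfold_locales (use O' in auto)
  obtain O2 L where L: "open O2" "O2 \<noteq> {}" "O2 \<subseteq> B" "clin L"
    "\<And>z w. K (L z) (L w) = (1 / c) * H z w" "\<And>z. z \<in> O2 \<Longrightarrow> f z - al z *s L z \<in> radical sg'"
    by (rule linear_on_open_subset) blast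
  have "\<forall>z\<in>O2. \<exists>\<alpha>. f z - \<alpha> *s L z \<in> radical sg'" using L(6) by blast
  with L(1-5) have "open O2 \<and> O2 \<noteq> {} \<and> O2 \<subseteq> B \<and> clin L \<and> 1 / c \<noteq> 0 \<and>
      (\<forall>z w. K (L z) (L w) = of_real (1 / c) * H z w) \<and> (\<forall>z\<in>O2. \<exists>\<alpha>. f z - \<alpha> *s L z \<in> radical sg')"
    using c_nz by simp
  then show ?thesis by blast
qed

section \<open>Globalization\<close>

lemma pt_scale: "c \<noteq> 0 \<Longrightarrow> pt (c *s z) = pt z"
  unfolding pt_def
proof (intro set_eqI iffI; clarify)
  fix k :: complex assume "c \<noteq> 0" "k \<noteq> 0"
  then show "\<exists>c'. k *s (c *s z) = c' *s z \<and> c' \<noteq> 0" by (intro exI[of _ "k * c"]) auto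
  show "\<exists>c'. k *s z = c' *s (c *s z) \<and> c' \<noteq> 0"
    using \<open>c \<noteq> 0\<close> \<open>k \<noteq> 0\<close> by (intro exI[of _ "k / c"]) auto
qed

lemma mem_pt: "z \<in> pt z"
  unfolding pt_def by (rule CollectI, rule exI[of _ 1]) simp

lemma pt_eq: "pt z = pt w \<Longrightarrow> \<exists>c. c \<noteq> 0 \<and> w = c *s z"
  using mem_pt[of w] unfolding pt_def by blast

definition cone_over :: "(complex^'n) set set \<Rightarrow> (complex^'n) set" where
  "cone_over U = {z. z \<noteq> 0 \<and> pt z \<in> U}"

lemma cone_over_scale: "c \<noteq> 0 \<Longrightarrow> c *s z \<in> cone_over U \<longleftrightarrow> z \<in> cone_over U"
  by (auto simp: cone_over_def pt_scale)

lemma open_scaled: "open V \<Longrightarrow> open {w. (c::complex) *s (w :: complex^'n::finite) \<in> V}"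
proof -
  have "bounded_linear (\<lambda>w :: complex^'n. c *s w)"
    by (rule bounded_linear_clin) (auto simp: clin_def vec.scale_right_distrib mult.commute)
  then show "open V \<Longrightarrow> open {w. c *s w \<in> V}"
    using open_vimage[OF _ linear_continuous_on] by (fastforce simp: vimage_def)
qed

lemma local_lift:
  assumes F: "proj_holo U F" and z: "z \<in> cone_over U"
  obtains B f where "open B" "convex B" "z \<in> B" "B \<subseteq> cone_over U" "cholo_on B f"
    "\<And>w. w \<in> B \<Longrightarrow> f w \<noteq> 0 \<and> F (pt w) = pt (f w)"
proof -
  obtain V f where V: "open V" "z \<in> V" "V \<subseteq> cone_over U" "cholo_on V f" "\<forall>w\<in>V. f w \<noteq> 0 \<and> F (pt w) = pt (f w)"
    using F z unfolding proj_holo_def cone_over_def by blast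
  obtain e where e: "e > 0" "ball z e \<subseteq> V" using V(1,2) open_contains_ball by blast
  show ?thesis
    by (rule that[of "ball z e" f]) (use e V cholo_on_subset in auto)
qed

text \<open>Homogeneity makes the relation independent of representatives. The points with a
  neighbourhood on which it holds form an open set, also closed in \<open>U\<close> by
  \<open>holo_scalar_zero_open\<close> on convex charts; \<open>U\<close> is connected.\<close>

lemma projective_identity_theorem:
  fixes U :: "(complex^'n::finite) set set" and F :: "(complex^'n) set \<Rightarrow> (complex^'m::finite) set"
    and Q :: "complex^'n \<Rightarrow> complex^'m \<Rightarrow> complex"
  assumes U: "openin proj_top U" "connectedin proj_top U" and F: "proj_holo U F"
    and holo: "\<And>V g. cholo_on V g \<Longrightarrow> holo_scalar V (\<lambda>z. Q z (g z))"
    and scale: "\<And>k l z x. k \<noteq> 0 \<Longrightarrow> l \<noteq> 0 \<Longrightarrow> Q z x = 0 \<Longrightarrow> Q (k *s z) (l *s x) = 0"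
    and V0: "open V0" "V0 \<noteq> {}" "V0 \<subseteq> cone_over U" "\<And>z. z \<in> V0 \<Longrightarrow> \<exists>x. F (pt z) = pt x \<and> Q z x = 0"
    and z: "z \<in> cone_over U" "F (pt z) = pt x"
  shows "Q z x = 0"
proof -
  define good where "good z \<longleftrightarrow> (\<forall>x. F (pt z) = pt x \<longrightarrow> Q z x = 0)" for z
  have goodI: "good z" if x: "F (pt z) = pt x" "Q z x = 0" for z x
    unfolding good_def
  proof (intro allI impI)
    fix x' assume "F (pt z) = pt x'"
    then obtain l where "l \<noteq> 0" "x' = l *s x" using x(1) pt_eq by metis
    then show "Q z x' = 0" using scale[of 1 l z x] x(2) by simp
  qed
  have good_scale: "good (k *s z)" if "k \<noteq> 0" "good z" for k z
    unfolding good_def using that scale[of k 1 z] by (auto simp: good_def pt_scale)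
  define A where "A = {pt z | z. \<exists>V. open V \<and> z \<in> V \<and> V \<subseteq> cone_over U \<and> (\<forall>w\<in>V. good w)}"
  have A: "\<exists>V. open V \<and> z \<in> V \<and> V \<subseteq> cone_over U \<and> (\<forall>w\<in>V. good w)" if pA: "pt z \<in> A" for z
  proof -
    obtain z' V where V: "pt z = pt z'" "open V" "z' \<in> V" "V \<subseteq> cone_over U" "\<forall>w\<in>V. good w"
      using pA unfolding A_def by blast
    obtain k where k: "k \<noteq> 0" "z' = k *s z" using pt_eq[OF V(1)] by blast
    show ?thesis
    proof (intro exI[of _ "{w. k *s w \<in> V}"] conjI)
      show "open {w. k *s w \<in> V}" by (rule open_scaled[OF V(2)])
      show "z \<in> {w. k *s w \<in> V}" using V(3) k by simp
      show "{w. k *s w \<in> V} \<subseteq> cone_over U" using V(4) cone_over_scale[OF k(1)] by blast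
      show "\<forall>w\<in>{w. k *s w \<in> V}. good w"
      proof
        fix w assume "w \<in> {w. k *s w \<in> V}"
        then have "good (k *s w)" using V(5) by blast
        from good_scale[OF _ this, of "1 / k"] show "good w" using k(1) by simp
      qed
    qed
  qed
  have AU: "A \<subseteq> U" by (auto simp: A_def cone_over_def)
  have UPS: "U \<subseteq> PS" using U(1) by (simp add: openin_proj_top)
  have openA: "openin proj_top A"
    unfolding openin_proj_top
  proof
    show "A \<subseteq> PS" using AU UPS by blast
    show "open {z. z \<noteq> 0 \<and> pt z \<in> A}"
    proof (subst open_subopen, intro ballI)
      fix z assume "z \<in> {z. z \<noteq> 0 \<and> pt z \<in> A}"
      then obtain V where V: "open V" "z \<in> V" "V \<subseteq> cone_over U" "\<forall>w\<in>V. good w" using A[of z] by auto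
      have "V \<subseteq> {z. z \<noteq> 0 \<and> pt z \<in> A}"
        using V unfolding A_def cone_over_def by blast
      then show "\<exists>T. open T \<and> z \<in> T \<and> T \<subseteq> {z. z \<noteq> 0 \<and> pt z \<in> A}" using V by blast
    qed
  qed
  have openUA: "openin proj_top (U - A)"
    unfolding openin_proj_top
  proof
    show "U - A \<subseteq> PS" using UPS by blast
    show "open {z. z \<noteq> 0 \<and> pt z \<in> U - A}"
    proof (subst open_subopen, intro ballI)
      fix z assume z: "z \<in> {z. z \<noteq> 0 \<and> pt z \<in> U - A}"
      then have "z \<in> cone_over U" by (auto simp: cone_over_def)
      then obtain B f where B: "open B" "convex B" "z \<in> B" "B \<subseteq> cone_over U" "cholo_on B f"
        "\<And>w. w \<in> B \<Longrightarrow> f w \<noteq> 0 \<and> F (pt w) = pt (f w)" using local_lift[OF F] by metis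
      \<comment> \<open>If a chart meets \<open>A\<close>, the relation spreads over the whole
        chart, including its centre \<open>z\<close>.\<close>
      have "pt w \<notin> A" if w: "w \<in> B" for w
      proof
        assume "pt w \<in> A"
        then obtain V where V: "open V" "w \<in> V" "\<forall>w\<in>V. good w" using A by blast
        have zero: "Q v (f v) = 0" if "v \<in> B" for v
          by (rule holo_scalar_zero_open[OF holo[OF B(5)] B(1,2), of "V \<inter> B" w])
             (use V B w that in \<open>auto simp: good_def\<close>)
        have "\<forall>v\<in>B. good v" using zero B(6) goodI by blast
        then have "pt z \<in> A" unfolding A_def using B by blast
        then show False using z by blast
      qed
      then have "B \<subseteq> {z. z \<noteq> 0 \<and> pt z \<in> U - A}" using B(4) by (auto simp: cone_over_def)
      then show "\<exists>T. open T \<and> z \<in> T \<and> T \<subseteq> {z. z \<noteq> 0 \<and> pt z \<in> U - A}" using B by blast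
    qed
  qed
  obtain v where v: "v \<in> V0" using V0(2) by blast
  have "\<forall>w\<in>V0. good w" using V0(4) goodI by blast
  then have "pt v \<in> A" unfolding A_def using V0 v by blast
  then have "A \<inter> U \<noteq> {}" using AU by blast
  then have "(U - A) \<inter> U = {}"
    using U(2) openA openUA unfolding connectedin by blast
  then have "pt z \<in> A" using z(1) by (auto simp: cone_over_def)
  then show ?thesis using A[of z] z(2) by (auto simp: good_def)
qed

text \<open>Adding a small multiple of a null vector with one positive and one negative coordinate
  moves a point out of the radical and keeps it null.\<close>

lemma nonradical_null_point:
  assumes sg: "is_sig sg" and r: "sig_r sg \<ge> 1" and s: "sig_s sg \<ge> 1"
    and S: "open S" "z \<in> S" "hform sg z z = 0"
  obtains p where "p \<in> S" "hform sg p p = 0" "p \<notin> radical sg"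
proof (cases "z \<in> radical sg")
  case False then show ?thesis using that S by blast
next
  case True
  obtain i j where ij: "sg i = 1" "sg j = -1"
    using r s unfolding sig_r_def sig_s_def by (metis (mono_tags) card.empty empty_Collect_eq not_one_le_zero)
  then have "i \<noteq> j" by auto
  define e :: "complex^'a" where "e = axis i 1 + axis j 1"
  have "axis i (1::complex) $ j = 0" "axis j (1::complex) $ i = 0" using \<open>i \<noteq> j\<close> by (simp_all add: axis_def)
  then have ee: "hform sg e e = 0" "e $ i = 1"
    using ij by (simp_all add: e_def hform_simps hform_axis)
  have "\<forall>\<^sub>F t in nhds (0::real). z + t *\<^sub>R e \<in> S"
  proof -
    have "((\<lambda>t. z + t *\<^sub>R e) \<longlongrightarrow> z + 0 *\<^sub>R e) (nhds 0)" by (intro tendsto_intros filterlim_ident)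
    then show ?thesis using S by (simp add: topological_tendstoD)
  qed
  then obtain t where t: "t > 0" "z + t *\<^sub>R e \<in> S" using eventually_small_pos zero_less_one by blast
  show ?thesis
  proof (rule that[OF t(2)])
    show "hform sg (z + t *\<^sub>R e) (z + t *\<^sub>R e) = 0"
      using True by (simp add: hform_simps hform_radical_left hform_radical_right ee)
    have "(z + t *\<^sub>R e) $ i \<noteq> 0" using True ij ee t by (simp add: radical_def)
    then show "z + t *\<^sub>R e \<notin> radical sg" using ij unfolding radical_def by force
  qed
qed

section \<open>The dichotomy on all of \<open>U\<close>\<close>

definition mutually_orthogonal_image ::
  "('m::finite \<Rightarrow> int) \<Rightarrow> (complex^'n) set set \<Rightarrow> ((complex^'n) set \<Rightarrow> (complex^'m) set) \<Rightarrow> bool" where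
  "mutually_orthogonal_image sg' U F \<longleftrightarrow> (\<forall>z\<in>cone_over U. \<forall>w\<in>cone_over U. \<forall>x y.
     F (pt z) = pt x \<longrightarrow> F (pt w) = pt y \<longrightarrow> hform sg' x y = 0)"

text \<open>Vanishing of minors is polynomial in both vectors, so it fits
  \<open>projective_identity_theorem\<close> and makes sense where \<open>L z\<close> is zero modulo
  the radical.\<close>

definition parallel_mod_radical ::
  "('m::finite \<Rightarrow> int) \<Rightarrow> (complex^'n) set set \<Rightarrow> ((complex^'n) set \<Rightarrow> (complex^'m) set) \<Rightarrow> (complex^'n \<Rightarrow> complex^'m) \<Rightarrow> bool" where
  "parallel_mod_radical sg' U F L \<longleftrightarrow> (\<forall>z\<in>cone_over U. \<forall>x. F (pt z) = pt x \<longrightarrow>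
     (\<forall>i j. sg' i \<noteq> 0 \<longrightarrow> sg' j \<noteq> 0 \<longrightarrow> x $ i * L z $ j = x $ j * L z $ i))"

text \<open>The local alternative at a null point outside the radical spreads over \<open>U\<close>
  by the identity theorem, applied to products in the first case and to minors in the
  second.\<close>

lemma dichotomy_low_index:
  fixes sg :: "'n::finite \<Rightarrow> int" and sg' :: "'m::finite \<Rightarrow> int"
  assumes sg: "is_sig sg" and sg': "is_sig sg'" and r: "sig_r sg \<ge> 2" and s: "sig_s sg \<ge> 2"
    and U: "openin proj_top U" "connectedin proj_top U" and null: "\<exists>p\<in>U. point_null sg p"
    and F: "local_orth_map sg sg' U F"
    and le: "sig_s sg' \<le> min (sig_r sg) (sig_s sg)"
  shows "mutually_orthogonal_image sg' U F \<or>
    (\<exists>L \<mu>. clin L \<and> \<mu> \<noteq> 0 \<and> (\<forall>z w. hform sg' (L z) (L w) = of_real \<mu> * hform sg z w) \<and> parallel_mod_radical sg' U F L)"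
proof -
  have holoF: "proj_holo U F" using F by (simp add: local_orth_map_def)
  obtain z0 where z0: "z0 \<in> cone_over U" "hform sg z0 z0 = 0"
    using null unfolding point_null_def cone_over_def by blast
  have "open (cone_over U)" using U(1) by (simp add: openin_proj_top cone_over_def)
  then obtain p where p: "p \<in> cone_over U" "hform sg p p = 0" "p \<notin> radical sg"
    using nonradical_null_point[OF sg _ _ _ z0] r s by (metis Suc_1 Suc_leD One_nat_def)
  obtain B f where B: "open B" "convex B" "p \<in> B" "B \<subseteq> cone_over U" "cholo_on B f"
        "\<And>w. w \<in> B \<Longrightarrow> f w \<noteq> 0 \<and> F (pt w) = pt (f w)" using local_lift[OF holoF p(1)] by metis
  obtain Df where Df: "\<And>z. z \<in> B \<Longrightarrow> (f has_derivative Df z) (at z) \<and> (\<forall>c x. Df z (c *s x) = c *s Df z x)"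
    using B(5) unfolding cholo_on_def by metis
  have orth: "hform sg' (f z) (f w) = 0" if zw: "z \<in> B" "w \<in> B" "hform sg z w = 0" for z w
  proof -
    have "z \<noteq> 0" "w \<noteq> 0" "pt z \<in> U" "pt w \<in> U" using B(4) zw by (auto simp: cone_over_def)
    then have "porth sg' (F (pt z)) (F (pt w))"
      using F zw(3) unfolding local_orth_map_def porth_def by blast
    then obtain x y where xy: "pt (f z) = pt x" "pt (f w) = pt y" "hform sg' x y = 0"
      using B(6)[OF zw(1)] B(6)[OF zw(2)] unfolding porth_def by auto
    then obtain k l where "f z = k *s x" "f w = l *s y" using pt_eq by metis
    then show ?thesis using xy(3) by (simp add: hform_simps)
  qed
  interpret local_orth sg sg' B f Df
    by unfold_locales (use sg sg' r s le B Df orth in auto)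
  note identity = projective_identity_theorem[OF U holoF]
  have Bne: "B \<noteq> {}" using B by blast
  from null_or_locally_linear[OF B(3) p(2,3)] show ?thesis
  proof (elim disjE exE conjE)
    assume N: "\<forall>z\<in>B. \<forall>w\<in>B. K (f z) (f w) = 0"
    \<comment> \<open>Extend one variable at a time: first \<open>z\<close> with \<open>w\<close> in
      the chart, then \<open>w\<close>.\<close>
    have 1: "K x (f w) = 0" if z: "z \<in> cone_over U" "F (pt z) = pt x" and w: "w \<in> B" for z x w
      by (rule identity[where Q = "\<lambda>z x. K x (f w)", OF holo_scalar_hform _ B(1) Bne B(4) _ z])
         (use N B w in \<open>auto simp: hform_simps\<close>)
    have "K x y = 0" if zw: "z \<in> cone_over U" "w \<in> cone_over U" "F (pt z) = pt x" "F (pt w) = pt y" for z w x y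
    proof -
      have "K y x = 0"
        by (rule identity[where Q = "\<lambda>w y. K y x", OF holo_scalar_hform _ B(1) Bne B(4) _ zw(2,4)])
           (use 1[OF zw(1,3)] hform_eq_0_commute[of sg' x] B in \<open>auto simp: hform_simps\<close>)
      then show ?thesis using hform_eq_0_commute by blast
    qed
    then show ?thesis unfolding mutually_orthogonal_image_def by blast
  next
    fix O2 L \<mu>
    assume L: "open O2" "O2 \<noteq> {}" "O2 \<subseteq> B" "clin L" "\<mu> \<noteq> 0" "\<forall>z w. K (L z) (L w) = of_real \<mu> * H z w"
      "\<forall>z\<in>O2. \<exists>\<alpha>. f z - \<alpha> *s L z \<in> radical sg'"
    have "x $ i * L z $ j = x $ j * L z $ i"
      if z: "z \<in> cone_over U" "F (pt z) = pt x" and ij: "sg' i \<noteq> 0" "sg' j \<noteq> 0" for z x i j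
    proof -
      have Lk: "L (k *s z) = k *s L z" for k z using L(4) by (simp add: clin_def)
      have "x $ i * L z $ j - x $ j * L z $ i = 0"
      proof (rule identity[where Q = "\<lambda>z x. x $ i * L z $ j - x $ j * L z $ i", OF _ _ L(1,2) _ _ z])
        show "O2 \<subseteq> cone_over U" using L B by blast
        show "holo_scalar V (\<lambda>z. g z $ i * L z $ j - g z $ j * L z $ i)" if "cholo_on V g" for V g
          by (intro holo_scalar_diff holo_scalar_mult holo_scalar_nth that cholo_on_clin L(4))
        show "(l *s x) $ i * L (k *s z) $ j - (l *s x) $ j * L (k *s z) $ i = 0"
          if "x $ i * L z $ j - x $ j * L z $ i = 0" for k l z x
          using that by (simp add: Lk)
        fix v assume v: "v \<in> O2"
        then obtain \<alpha> where "f v - \<alpha> *s L v \<in> radical sg'" using L(7) by blast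
        then have "f v $ i = \<alpha> * L v $ i" "f v $ j = \<alpha> * L v $ j" using ij by (auto simp: radical_def)
        then show "\<exists>x. F (pt v) = pt x \<and> x $ i * L v $ j - x $ j * L v $ i = 0"
          using B(6) L(3) v by (intro exI[of _ "f v"]) auto
      qed
      then show ?thesis by simp
    qed
    then show ?thesis using L unfolding parallel_mod_radical_def by blast
  qed
qed

text \<open>Orthogonality does not see the sign of the target form; changing it exchanges the
  numbers of positive and negative squares and replaces \<open>\<mu>\<close> by
  \<open>- \<mu>\<close>.\<close>

lemma dichotomy:
  fixes sg :: "'n::finite \<Rightarrow> int" and sg' :: "'m::finite \<Rightarrow> int"
  assumes sg: "is_sig sg" and sg': "is_sig sg'" and r: "sig_r sg \<ge> 2" and s: "sig_s sg \<ge> 2"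
    and U: "openin proj_top U" "connectedin proj_top U" and null: "\<exists>p\<in>U. point_null sg p"
    and F: "local_orth_map sg sg' U F"
    and le: "min (sig_r sg') (sig_s sg') \<le> min (sig_r sg) (sig_s sg)"
  shows "mutually_orthogonal_image sg' U F \<or>
    (\<exists>L \<mu>. clin L \<and> \<mu> \<noteq> 0 \<and> (\<forall>z w. hform sg' (L z) (L w) = of_real \<mu> * hform sg z w) \<and> parallel_mod_radical sg' U F L)"
proof (cases "sig_s sg' \<le> min (sig_r sg) (sig_s sg)")
  case True
  show ?thesis by (rule dichotomy_low_index[OF sg sg' r s U null F True])
next
  case False
  let ?sg' = "\<lambda>i. - sg' i"
  have "is_sig ?sg'" using sg' by (auto simp: is_sig_def)
  moreover have "local_orth_map sg ?sg' U F"
    using F by (simp add: local_orth_map_def porth_def hform_uminus_sign)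
  moreover have "sig_s ?sg' \<le> min (sig_r sg) (sig_s sg)"
    using False le by (auto simp: sig_s_def sig_r_def)
  ultimately have "mutually_orthogonal_image ?sg' U F \<or>
    (\<exists>L \<mu>. clin L \<and> \<mu> \<noteq> 0 \<and> (\<forall>z w. hform ?sg' (L z) (L w) = of_real \<mu> * hform sg z w) \<and> parallel_mod_radical ?sg' U F L)"
    using dichotomy_low_index[OF sg _ r s U null] by blast
  then show ?thesis
  proof (elim disjE exE conjE)
    assume "mutually_orthogonal_image ?sg' U F"
    then show ?thesis by (simp add: mutually_orthogonal_image_def hform_uminus_sign)
  next
    fix L \<mu> assume L: "clin L" "\<mu> \<noteq> 0" "\<forall>z w. hform ?sg' (L z) (L w) = of_real \<mu> * hform sg z w"
      "parallel_mod_radical ?sg' U F L"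
    have "hform sg' (L z) (L w) = of_real (- \<mu>) * hform sg z w" for z w
    proof -
      have "- hform sg' (L z) (L w) = of_real \<mu> * hform sg z w"
        using L(3) by (simp add: hform_uminus_sign)
      then show ?thesis by (simp add: minus_equation_iff eq_commute)
    qed
    moreover have "parallel_mod_radical sg' U F L" using L(4) by (simp add: parallel_mod_radical_def)
    ultimately show ?thesis using L(1,2)
      by (intro disjI2 exI[of _ L] exI[of _ "- \<mu>"]) simp
  qed
qed

text \<open>The null space is the double orthogonal complement \<open>X\<close> of the set
  \<open>S\<close> of representatives: \<open>S \<subseteq> P\<close> gives
  \<open>X \<subseteq> P\<close>, and \<open>X\<close> is orthogonal to \<open>P\<close>.\<close>

lemma null_pmap_if_mutually_orthogonal:
  assumes UPS: "U \<subseteq> PS" and FPS: "\<forall>p\<in>U. F p \<in> PS" and N: "mutually_orthogonal_image sg' U F"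
  shows "null_pmap sg' U F"
proof -
  define S where "S = {x. \<exists>p\<in>U. F p = pt x}"
  define P where "P = {y. \<forall>x\<in>S. hform sg' y x = 0}"
  define X where "X = {z. \<forall>y\<in>P. hform sg' z y = 0}"
  have SP: "S \<subseteq> P"
  proof
    fix x assume "x \<in> S"
    then obtain p where p: "p \<in> U" "F p = pt x" by (auto simp: S_def)
    then obtain z where z: "z \<in> cone_over U" "p = pt z" using UPS by (auto simp: PS_def cone_over_def)
    show "x \<in> P" unfolding P_def
    proof (intro CollectI ballI)
      fix y assume "y \<in> S"
      then obtain q where q: "q \<in> U" "F q = pt y" by (auto simp: S_def)
      then obtain w where "w \<in> cone_over U" "q = pt w" using UPS by (auto simp: PS_def cone_over_def)
      then show "hform sg' x y = 0" using N z p q unfolding mutually_orthogonal_image_def by blast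
    qed
  qed
  have "null_space sg' X" unfolding null_space_def
  proof (intro conjI ballI)
    show "csubspace X" by (auto simp: csubspace_def X_def hform_simps)
    fix x y assume "x \<in> X" "y \<in> X"
    then show "hform sg' x y = 0" using SP unfolding X_def P_def by blast
  qed
  moreover have "F p \<subseteq> X" if p: "p \<in> U" for p
  proof
    fix v assume v: "v \<in> F p"
    obtain x where x: "F p = pt x" using FPS p by (auto simp: PS_def)
    then obtain k where "k \<noteq> 0" "v = k *s x" using v by (auto simp: pt_def)
    then have "v \<in> S" using x p by (auto simp: S_def pt_scale)
    then show "v \<in> X" using hform_eq_0_commute by (auto simp: X_def P_def)
  qed
  ultimately show ?thesis unfolding null_pmap_def by blast
qed

section \<open>Splitting off the radical\<close>

definition nonradical_part :: "('m::finite \<Rightarrow> int) \<Rightarrow> complex^'m \<Rightarrow> complex^'m" where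
  "nonradical_part sg x = (\<chi> i. if sg i \<noteq> 0 then x $ i else 0)"

text \<open>The coordinate complement of the radical; the two serve as \<open>A\<close> and
  \<open>B\<close> in the quasi-linear and quasi-standard cases.\<close>

definition coradical :: "('m::finite \<Rightarrow> int) \<Rightarrow> (complex^'m) set" where
  "coradical sg = {x. \<forall>i. sg i = 0 \<longrightarrow> x $ i = 0}"

lemma nonradical_part_coradical: "nonradical_part sg x \<in> coradical sg"
  by (simp add: nonradical_part_def coradical_def)

lemma minus_nonradical_part: "x - nonradical_part sg x \<in> radical sg"
  by (simp add: nonradical_part_def radical_def)

lemma nonradical_part_eq_0: "nonradical_part sg x = 0 \<longleftrightarrow> x \<in> radical sg"
  by (auto simp: nonradical_part_def radical_def vec_eq_iff)

lemma nonradical_part_id: "sig_t sg = 0 \<Longrightarrow> nonradical_part sg = id"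
  by (auto simp: nonradical_part_def sig_t_def vec_eq_iff)

lemma clin_nonradical_part: "clin L \<Longrightarrow> clin (\<lambda>z. nonradical_part sg (L z))"
  by (auto simp: clin_def nonradical_part_def vec_eq_iff)

lemma hform_nonradical_part: "hform sg (nonradical_part sg x) (nonradical_part sg y) = hform sg x y"
  unfolding hform_def by (intro sum.cong) (auto simp: nonradical_part_def)

lemma proj_on_nonradical_part: "proj_on (coradical sg) (radical sg) = nonradical_part sg"
proof
  fix x
  show "proj_on (coradical sg) (radical sg) x = nonradical_part sg x"
    unfolding proj_on_def
  proof (rule the_equality)
    show "nonradical_part sg x \<in> coradical sg \<and> (\<exists>b\<in>radical sg. x = nonradical_part sg x + b)"
      using nonradical_part_coradical minus_nonradical_part[of x sg] by (auto intro!: bexI)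
    fix a assume "a \<in> coradical sg \<and> (\<exists>b\<in>radical sg. x = a + b)"
    then show "a = nonradical_part sg x"
      by (auto simp: coradical_def radical_def nonradical_part_def vec_eq_iff)
  qed
qed

lemma proj_on_radical: "proj_on (radical sg) (coradical sg) x = x - nonradical_part sg x"
  unfolding proj_on_def
proof (rule the_equality)
  show "x - nonradical_part sg x \<in> radical sg \<and> (\<exists>b\<in>coradical sg. x = x - nonradical_part sg x + b)"
    using nonradical_part_coradical minus_nonradical_part[of x sg] by (auto intro!: bexI)
  fix a assume "a \<in> radical sg \<and> (\<exists>b\<in>coradical sg. x = a + b)"
  then show "a = x - nonradical_part sg x"
    by (auto simp: coradical_def radical_def nonradical_part_def vec_eq_iff)
qed

lemma orth_decomp_radical:
  assumes "sig_t sg \<noteq> 0" "x \<notin> radical sg"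
  shows "orth_decomp sg (coradical sg) (radical sg)"
  unfolding orth_decomp_def
proof (intro conjI)
  show "csubspace (coradical sg)" "csubspace (radical sg)"
    by (auto simp: csubspace_def coradical_def radical_def)
  show "coradical sg \<noteq> {0}"
    using nonradical_part_coradical[of sg x] nonradical_part_eq_0[of sg x] assms(2) by auto
  obtain i where i: "sg i = 0" using assms(1) by (auto simp: sig_t_def)
  have "axis i 1 \<in> radical sg" using i by (auto simp: radical_def axis_def)
  moreover have "axis i (1::complex) \<noteq> 0" by (simp add: axis_eq_0_iff)
  ultimately show "radical sg \<noteq> {0}" by blast
  have "x $ i = 0" if "x \<in> coradical sg" "x \<in> radical sg" for x i
    using that by (cases "sg i = 0") (auto simp: coradical_def radical_def)
  then show "coradical sg \<inter> radical sg = {0}"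
    by (auto simp: vec_eq_iff) (simp_all add: coradical_def radical_def)
  show "\<forall>w. \<exists>a\<in>coradical sg. \<exists>b\<in>radical sg. w = a + b"
  proof
    fix w
    have "w = nonradical_part sg w + (w - nonradical_part sg w)" by simp
    then show "\<exists>a\<in>coradical sg. \<exists>b\<in>radical sg. w = a + b"
      using nonradical_part_coradical minus_nonradical_part by blast
  qed
  show "\<forall>a\<in>coradical sg. \<forall>b\<in>radical sg. hform sg a b = 0" using hform_radical_right by blast
qed

lemma proj_null_radical: "proj_null sg (coradical sg) (radical sg) U F"
  unfolding proj_null_def
proof (intro exI[of _ "radical sg"] conjI)
  show "null_space sg (radical sg)"
    unfolding null_space_def using hform_radical_left by (auto simp: csubspace_def radical_def)
qed (auto simp: proj_on_radical minus_nonradical_part)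

lemma parallel_vectors:
  fixes u v :: "complex^'k::finite"
  assumes "u \<noteq> 0" "v \<noteq> 0" "\<And>i j. u $ i * v $ j = u $ j * v $ i"
  obtains k where "k \<noteq> 0" "v = k *s u"
proof -
  obtain i where i: "u $ i \<noteq> 0" using assms(1) by (auto simp: vec_eq_iff)
  have v: "v = (v $ i / u $ i) *s u"
    using assms(3)[of i] i by (auto simp: vec_eq_iff field_simps)
  moreover have "v $ i / u $ i \<noteq> 0" using v assms(2) by auto
  ultimately show ?thesis using that by blast
qed

lemma parallel_mod_radical_obtain:
  assumes par: "parallel_mod_radical sg' U F L" and z: "z \<in> cone_over U" "F (pt z) = pt x"
    and nz: "nonradical_part sg' x \<noteq> 0" "nonradical_part sg' (L z) \<noteq> 0"
  obtains k where "k \<noteq> 0" "nonradical_part sg' (L z) = k *s nonradical_part sg' x"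
proof (rule parallel_vectors[OF nz])
  fix i j
  show "nonradical_part sg' x $ i * nonradical_part sg' (L z) $ j = nonradical_part sg' x $ j * nonradical_part sg' (L z) $ i"
    using par z unfolding parallel_mod_radical_def nonradical_part_def by auto
qed

lemma agrees_with_nonradical_part:
  assumes par: "parallel_mod_radical sg' U F L" and L: "clin L"
    and nz: "nonradical_part sg' (L z0) \<noteq> 0"
    and z1: "z1 \<in> cone_over U" "F (pt z1) = pt x1" "x1 \<notin> radical sg'"
  shows "agrees_with U F (nonradical_part sg') (\<lambda>z. nonradical_part sg' (L z))"
  unfolding agrees_with_def
proof (intro conjI allI impI)
  show "clin (\<lambda>z. nonradical_part sg' (L z))" by (rule clin_nonradical_part[OF L])
  show "\<exists>z. nonradical_part sg' (L z) \<noteq> 0" using nz by blast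
  show "\<exists>z w. z \<noteq> 0 \<and> pt z \<in> U \<and> F (pt z) = pt w \<and> nonradical_part sg' w \<noteq> 0"
    using z1 by (auto simp: cone_over_def nonradical_part_eq_0)
  fix z w assume zw: "z \<noteq> 0" "pt z \<in> U" "F (pt z) = pt w" "nonradical_part sg' w \<noteq> 0" "nonradical_part sg' (L z) \<noteq> 0"
  then have "z \<in> cone_over U" by (simp add: cone_over_def)
  from parallel_mod_radical_obtain[OF par this zw(3-5)]
  obtain k where "k \<noteq> 0" "nonradical_part sg' (L z) = k *s nonradical_part sg' w" by blast
  then show "pt (nonradical_part sg' w) = pt (nonradical_part sg' (L z))" by (simp add: pt_scale)
qed

theorem mainTheorem6:
  fixes sg :: "'n::finite \<Rightarrow> int" and sg' :: "'m::finite \<Rightarrow> int"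
    and U :: "(complex^'n) set set" and F :: "(complex^'n) set \<Rightarrow> (complex^'m) set"
  assumes "is_sig sg" and "is_sig sg'"
    and "sig_r sg \<ge> 2" and "sig_s sg \<ge> 2"
    and "openin proj_top U" and "connectedin proj_top U"
    and "\<exists>p\<in>U. point_null sg p"
    and "local_orth_map sg sg' U F"
    and "min (sig_r sg') (sig_s sg') \<le> min (sig_r sg) (sig_s sg)"
  shows "(null_pmap sg' U F \<or> quasi_linear sg' U F)
       \<and> (sig_t sg' = 0 \<longrightarrow> null_pmap sg' U F \<or> linear_pmap U F)
       \<and> ((\<exists>p\<in>U. point_pos sg p \<and> point_pos sg' (F p)) \<or>
          (\<exists>p\<in>U. point_neg sg p \<and> point_neg sg' (F p))
          \<longrightarrow> quasi_standard sg sg' U F \<and> (sig_t sg' = 0 \<longrightarrow> standard_pmap sg sg' U F))"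
proof (cases "mutually_orthogonal_image sg' U F")
  case True
  have "null_pmap sg' U F"
    by (rule null_pmap_if_mutually_orthogonal[OF _ _ True])
       (use assms(5,8) in \<open>auto simp: openin_proj_top local_orth_map_def proj_holo_def\<close>)
  \<comment> \<open>All values are null points here, so no sign hypothesis can hold.\<close>
  moreover have "hform sg' x x = 0" if "p \<in> U" "p = pt z" "z \<noteq> 0" "F p = pt x" for p z x
    using True that unfolding mutually_orthogonal_image_def cone_over_def by blast
  then have "\<not> (\<exists>p\<in>U. point_pos sg p \<and> point_pos sg' (F p))" "\<not> (\<exists>p\<in>U. point_neg sg p \<and> point_neg sg' (F p))"
    unfolding point_pos_def point_neg_def by (metis less_irrefl zero_complex.simps(1))+
  ultimately show ?thesis by blast
next
  case False
  then obtain L \<mu> where L: "clin L" "\<mu> \<noteq> 0" "\<And>z w. hform sg' (L z) (L w) = of_real \<mu> * hform sg z w"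
    "parallel_mod_radical sg' U F L"
    using dichotomy[OF assms] by blast
  \<comment> \<open>Failure of mutual orthogonality produces a value outside the radical, at which
    the projected map is defined.\<close>
  obtain z1 x1 where z1: "z1 \<in> cone_over U" "F (pt z1) = pt x1" "x1 \<notin> radical sg'"
    using False hform_radical_left unfolding mutually_orthogonal_image_def by blast
  have nonrad: "nonradical_part sg' (L z) \<noteq> 0" if "hform sg z z \<noteq> 0" for z
  proof
    assume "nonradical_part sg' (L z) = 0"
    then have "hform sg' (L z) (L z) = 0" using hform_radical_left nonradical_part_eq_0 by blast
    then show False using that L by simp
  qed
  obtain i where i: "sg i = 1"
    using assms(3) unfolding sig_r_def by (metis (mono_tags) card.empty empty_Collect_eq not_numeral_le_zero)
  have z0: "hform sg (axis i 1) (axis i 1) \<noteq> 0" using i by (simp add: hform_axis)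
  note od = orth_decomp_radical[OF _ z1(3)]
  have agrees: "agrees_with U F (nonradical_part sg') (\<lambda>z. nonradical_part sg' (L z))"
    by (rule agrees_with_nonradical_part[OF L(4,1) nonrad[OF z0] z1])
  have lin: "linear_pmap U F" if "sig_t sg' = 0"
    using agrees unfolding linear_pmap_def nonradical_part_id[OF that] by blast
  have qlin: "quasi_linear sg' U F"
  proof (cases "sig_t sg' = 0")
    case True then show ?thesis using lin unfolding quasi_linear_def by blast
  next
    case False
    show ?thesis unfolding quasi_linear_def
      by (rule disjI2, intro exI[of _ "coradical sg'"] exI[of _ "radical sg'"] conjI od[OF False] proj_null_radical
           exI[of _ "\<lambda>z. nonradical_part sg' (L z)"])
         (use agrees in \<open>auto simp: proj_on_nonradical_part nonradical_part_coradical\<close>)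
  qed
  have std: "quasi_standard sg sg' U F \<and> (sig_t sg' = 0 \<longrightarrow> standard_pmap sg sg' U F)"
    if zx: "z \<in> cone_over U" "F (pt z) = pt x" "Re (hform sg z z) * Re (hform sg' x x) > 0" for z x
  proof -
    have nz: "hform sg z z \<noteq> 0" "x \<notin> radical sg'"
      using zx(3) hform_radical_left[of x sg' x] by auto
    then have nx: "nonradical_part sg' x \<noteq> 0" by (simp add: nonradical_part_eq_0)
    obtain k where k: "k \<noteq> 0" "nonradical_part sg' (L z) = k *s nonradical_part sg' x"
      using parallel_mod_radical_obtain[OF L(4) zx(1,2) nx nonrad[OF nz(1)]] by blast
    \<comment> \<open>\<open>L z\<close> and \<open>x\<close> are parallel modulo the radical, so
      comparing squares gives \<open>\<mu>\<close> the sign of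
      \<open>Re (hform sg z z) * Re (hform sg' x x)\<close>.\<close>
    have "of_real \<mu> * hform sg z z = hform sg' (nonradical_part sg' (L z)) (nonradical_part sg' (L z))"
      by (simp add: hform_nonradical_part L(3))
    also have "\<dots> = k * cnj k * hform sg' x x"
      unfolding k(2) by (simp add: hform_simps hform_nonradical_part)
    also have "k * cnj k = of_real ((norm k)\<^sup>2)" by (simp add: complex_norm_square del: of_real_power)
    finally have "\<mu> * Re (hform sg z z) = (norm k)\<^sup>2 * Re (hform sg' x x)"
      by (metis Re_complex_of_real complex_scaleR scaleR_conv_of_real scaleR_complex.simps(1))
    then have "\<mu> * (Re (hform sg z z))\<^sup>2 = (norm k)\<^sup>2 * (Re (hform sg z z) * Re (hform sg' x x))"
      by (simp add: power2_eq_square mult.assoc[symmetric] mult.left_commute)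
    moreover have "\<dots> > 0" using k zx(3) by simp
    ultimately have \<mu>: "\<mu> > 0" by (metis less_asym mult_nonpos_nonneg not_less zero_le_power2)
    \<comment> \<open>The positive factor \<open>\<mu>\<close> is scaled away, which turns
      \<open>L\<close> into an isometry.\<close>
    define M where "M z = complex_of_real (1 / sqrt \<mu>) *s L z" for z
    have M: "clin M" using L(1) by (auto simp: M_def clin_def vec_eq_iff algebra_simps)
    have par: "parallel_mod_radical sg' U F M"
      using L(4) by (simp add: parallel_mod_radical_def M_def mult.left_commute)
    have "hform sg' (M u) (M v) = hform sg u v" for u v
    proof -
      have "hform sg' (M u) (M v) = of_real (1 / sqrt \<mu>) * (of_real (1 / sqrt \<mu>) * (of_real \<mu> * hform sg u v))"
        by (simp only: M_def hform_scale_left hform_scale_right L(3) complex_cnj_complex_of_real)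
      also have "\<dots> = of_real (1 / sqrt \<mu> * (1 / sqrt \<mu> * \<mu>)) * hform sg u v"
        by (simp only: of_real_mult mult.assoc)
      also have "1 / sqrt \<mu> * (1 / sqrt \<mu> * \<mu>) = 1" using \<mu> by (simp add: field_simps)
      finally show ?thesis by simp
    qed
    then have iso: "isometry sg sg' (\<lambda>z. nonradical_part sg' (M z))"
      unfolding isometry_def by (simp add: clin_nonradical_part[OF M] hform_nonradical_part)
    have "nonradical_part sg' (M (axis i 1)) \<noteq> 0"
      using nonrad[OF z0] \<mu> by (simp add: M_def nonradical_part_eq_0 radical_def)
    then have ag: "agrees_with U F (nonradical_part sg') (\<lambda>z. nonradical_part sg' (M z))"
      by (rule agrees_with_nonradical_part[OF par M _ z1])
    have s: "standard_pmap sg sg' U F" if "sig_t sg' = 0"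
      using ag iso unfolding standard_pmap_def nonradical_part_id[OF that] by blast
    moreover have "quasi_standard sg sg' U F" if "sig_t sg' \<noteq> 0"
      unfolding quasi_standard_def
      by (rule disjI2, intro exI[of _ "coradical sg'"] exI[of _ "radical sg'"] conjI od[OF that] proj_null_radical
           exI[of _ "\<lambda>z. nonradical_part sg' (M z)"])
         (use ag iso in \<open>auto simp: proj_on_nonradical_part nonradical_part_coradical\<close>)
    ultimately show ?thesis unfolding quasi_standard_def by blast
  qed
  have "quasi_standard sg sg' U F \<and> (sig_t sg' = 0 \<longrightarrow> standard_pmap sg sg' U F)"
    if signs: "(\<exists>p\<in>U. point_pos sg p \<and> point_pos sg' (F p)) \<or> (\<exists>p\<in>U. point_neg sg p \<and> point_neg sg' (F p))"
  proof -
    obtain z x where "z \<noteq> 0" "pt z \<in> U" "F (pt z) = pt x" "Re (hform sg z z) * Re (hform sg' x x) > 0"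
      using signs unfolding point_pos_def point_neg_def by (metis mult_neg_neg mult_pos_pos)
    then show ?thesis using std by (simp add: cone_over_def)
  qed
  then show ?thesis using lin qlin by blast
qed

end
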